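(* Let $L>0$ and let $\sigma:\mathbb{Z}'\to[0,1]$ satisfy $\sum_{l\in\mathbb{Z}',\,l<0}\sigma(l)<\infty$. For every $s\in\mathbb{Z}'$ such that $Q_\sigma(L,s)>0$, \[ \frac{\partial^2}{\partial L^2}\log Q_\sigma(L,s)+\frac 1L\frac{\partial}{\partial L}\log Q_\sigma(L,s)+4=4\,\frac{Q_\sigma(L,s+1)\,Q_\sigma(L,s-1)}{Q_\sigma(L,s)^2}. \]
   Context: $\mathbb{Z}'=\mathbb{Z}+\tfrac12$. $\mathrm{J}_k$ denotes the Bessel function of the first kind of order $k$. For $L>0$ and $\sigma$ as in the claim, define the kernel $K_\sigma(a,b)=\sum_{l\in\mathbb{Z}'}\sigma(l)\mathrm{J}_{a+l}(2L)\mathrm{J}_{b+l}(2L)$ for $a,b\in\mathbb{Z}'$; a kernel $X$ induces the operator $(\mathcal X\psi)(a)=\sum_{b\in\mathbb{Z}'}X(a,b)\psi(b)$ on $\ell^2(\mathbb{Z}')$. For $s\in\mathbb{Z}'$, $P_s$ is the orthogonal projection of $\ell^2(\mathbb{Z}')$ onto $\ell^2(\{s+1,s+2,\dots\})$. The operator $P_s\mathcal K_\sigma P_s$ is trace class, and $Q_\sigma(L,s):=\det(1-P_s\mathcal K_\sigma P_s)$ (Fredholm determinant); it is the probability that the largest particle of the determinantal point process on $\mathbb{Z}'$ with correlation kernel $K_\sigma$ is $\le s$. *)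

theory Defs
  imports "HOL-Analysis.Analysis"
begin

definition Zh :: "real set" where
  "Zh = {x. \<exists>k::int. x = of_int k + 1/2}"

definition besselJ_nat :: "nat \<Rightarrow> real \<Rightarrow> real" where
  "besselJ_nat n x = (\<Sum>k. (-1)^k / (fact k * fact (k + n)) * (x / 2) ^ (2 * k + n))"

definition besselJ_int :: "int \<Rightarrow> real \<Rightarrow> real" where
  "besselJ_int k x = (if k \<ge> 0 then besselJ_nat (nat k) x
                      else (-1) ^ nat (-k) * besselJ_nat (nat (-k)) x)"

text \<open>J_k for a real order k that is an integer (only used with k integral).\<close>
definition besselJ :: "real \<Rightarrow> real \<Rightarrow> real" where
  "besselJ k x = besselJ_int \<lfloor>k\<rfloor> x"

definition Ksig :: "(real \<Rightarrow> real) \<Rightarrow> real \<Rightarrow> real \<Rightarrow> real \<Rightarrow> real" where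
  "Ksig \<sigma> L a b = (\<Sum>\<^sub>\<infinity>l\<in>Zh. \<sigma> l * besselJ (a + l) (2 * L) * besselJ (b + l) (2 * L))"

definition kdet :: "(real \<Rightarrow> real \<Rightarrow> real) \<Rightarrow> nat \<Rightarrow> (nat \<Rightarrow> real) \<Rightarrow> real" where
  "kdet X n x = (\<Sum>p | p permutes {..<n}. of_int (sign p) * (\<Prod>i<n. X (x i) (x (p i))))"

text \<open>Fredholm determinant det(1 - P_s X P_s) on l^2(Z'), via the Fredholm series,
  P_s being the projection onto l^2({s+1, s+2, ...}) = l^2({x in Z'. x > s}).\<close>
definition fredholm_det :: "(real \<Rightarrow> real \<Rightarrow> real) \<Rightarrow> real \<Rightarrow> real" where
  "fredholm_det X s =
     (\<Sum>n. (-1) ^ n / fact n *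
        (\<Sum>\<^sub>\<infinity>x\<in>PiE {..<n} (\<lambda>_. {y \<in> Zh. y > s}). kdet X n x))"

definition Qsig :: "(real \<Rightarrow> real) \<Rightarrow> real \<Rightarrow> real \<Rightarrow> real" where
  "Qsig \<sigma> L s = fredholm_det (Ksig \<sigma> L) s"

end

(*
  Expanding K_sigma in the vectors v_l(x) = J_{x+l}(2L) and exchanging the sums over x and l in the
  Fredholm series gives the dual form Q_sigma(L,s) = det(1 - sqrt(sigma) B_s sqrt(sigma)) on l^2(Z'),
  where B_s(l,l') = sum_{x>s} J_{x+l}(2L) J_{x+l'}(2L) is the discrete Bessel kernel. It is integrable:
  with p(l) = J_{s+l}(2L) and q(l) = J_{s+1+l}(2L), telescoping yields
    dB_s/dL = p q^T + q p^T,   (l - l') B_s(l,l') = L (p q^T - q p^T)(l,l'),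
    B_{s-1} = B_s + p p^T,     B_{s+1} = B_s - q q^T.
  If sigma has finite support, the determinant is finite. With R = (1 - sqrt(sigma) B_s sqrt(sigma))^{-1}
  (and sqrt(sigma) absorbed into p, q) the relations give (log Q)' = -2 u for u = q^T R p,
    Q_{s-1} / Q_s = 1 - p^T R p,   Q_{s+1} / Q_s = 1 + q^T R q,
  and u' = -u/L + 2 - 2 (1 - p^T R p) (1 + q^T R q), which is the claim.
  In general sigma is cut off to |l| < N. Row sum bounds on the minors make the Fredholm series converge
  uniformly for bounded L, and the equation (L (log Q)')' = L h, in which no derivative of Q occurs in h,
  passes to the limit.
*)
theory Submission
  imports Defs "Jordan_Normal_Form.Determinant"
begin

section \<open>Bessel functions of integer order\<close>

text \<open>In the original form \<open>s\<close> only cuts the space and sigma sits inside the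
  kernel. The dual form turns sigma into a weight free of \<open>L\<close> and \<open>s\<close> and
  moves both variables into a kernel whose \<open>L\<close>-derivative and \<open>s\<close>-shifts
  have rank at most two and one.

  Multiplication by \<open>l\<close> is what threatens to keep the system from closing: p' = ((s +
  l)/L) p - 2 q and q' = 2 p - ((s + 1 + l)/L) q contain it, so u' could bring in new unknowns such
  as q^T R l p. In u' it occurs only as the difference of its actions on the two sides of R, that is
  through a commutator, which is again of rank at most two. Its value cancels the u^2 that comes
  from R' and doubles the product (p^T R p)(q^T R q); this is why the right-hand side factors.

  In the limit the bounds on minors control Q but not its derivatives. The equation supplies these
  itself: uniform convergence of h together with pointwise convergence of log Q already forces
  uniform convergence of (log Q)'.\<close>

definition bessel_coeff :: "nat \<Rightarrow> nat \<Rightarrow> real" where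
  "bessel_coeff k j = (-1) ^ j / (fact j * fact (j + k))"

text \<open>The Bessel-Clifford function at -y, entire in \<open>y\<close>. The factor t^k of
  J_k(2t) is split off, so that differentiation merely raises \<open>k\<close> and changes the
  sign.\<close>

definition bessel_series :: "nat \<Rightarrow> real \<Rightarrow> real" where
  "bessel_series k y = (\<Sum>j. bessel_coeff k j * y ^ j)"

text \<open>Of (j + k)! only k! is kept: the remaining j! gives an exponential series, and k! later
  yields the decay in the order.\<close>

lemma bessel_term_bound: "\<bar>bessel_coeff k j * y ^ j\<bar> \<le> (\<bar>y\<bar> ^ j / fact j) / fact k"
proof -
  have "(fact k :: real) \<le> fact (j + k)" by (rule fact_mono) auto
  then have "\<bar>y\<bar> ^ j / (fact j * fact (j + k)) \<le> \<bar>y\<bar> ^ j / (fact j * fact k)"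
    by (intro divide_left_mono mult_left_mono) auto
  then show ?thesis
    by (simp add: bessel_coeff_def abs_mult power_abs)
qed

lemma summable_exp_div: "summable (\<lambda>j. (x ^ j / fact j) / c)" for x c :: real
  using summable_divide[OF summable_exp[of x], of c] by (simp add: field_simps)

lemma summable_bessel_series: "summable (\<lambda>j. bessel_coeff k j * y ^ j)"
  by (rule summable_comparison_test'[OF summable_exp_div[of "\<bar>y\<bar>" "fact k"], of 0])
    (use bessel_term_bound in auto)

lemma bessel_series_bound: "\<bar>bessel_series k y\<bar> \<le> exp \<bar>y\<bar> / fact k"
proof -
  have s: "summable (\<lambda>j. \<bar>bessel_coeff k j * y ^ j\<bar>)"
    by (rule summable_comparison_test'[OF summable_exp_div[of "\<bar>y\<bar>" "fact k"], of 0])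
      (use bessel_term_bound in auto)
  have "\<bar>bessel_series k y\<bar> \<le> (\<Sum>j. \<bar>bessel_coeff k j * y ^ j\<bar>)"
    unfolding bessel_series_def by (rule summable_rabs[OF s])
  also have "\<dots> \<le> (\<Sum>j. (\<bar>y\<bar> ^ j / fact j) / fact k)"
    by (intro suminf_le bessel_term_bound s summable_exp_div)
  also have "\<dots> = (\<Sum>j. \<bar>y\<bar> ^ j / fact j) / fact k"
    using summable_exp_div[of "\<bar>y\<bar>" 1] by (subst suminf_divide) auto
  also have "(\<Sum>j. \<bar>y\<bar> ^ j / fact j) = exp \<bar>y\<bar>"
    by (simp add: exp_def field_simps)
  finally show ?thesis .
qed

lemma bessel_series_deriv:
  "(bessel_series k has_real_derivative - bessel_series (Suc k) y) (at y)"
proof -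
  have d: "diffs (bessel_coeff k) j = - bessel_coeff (Suc k) j" for j
    unfolding diffs_def bessel_coeff_def fact_Suc[of j] add_Suc add_Suc_right
    by (simp add: mult.assoc del: of_nat_Suc fact_Suc)
  have "((\<lambda>x. \<Sum>j. bessel_coeff k j * x ^ j) has_real_derivative
         (\<Sum>j. diffs (bessel_coeff k) j * y ^ j)) (at y)"
    by (rule termdiffs_strong_converges_everywhere[OF summable_bessel_series])
  then show ?thesis
    using suminf_minus[OF summable_bessel_series[of "Suc k" y]]
    by (simp add: bessel_series_def[abs_def] d)
qed

lemma bessel_series_rec:
  "bessel_series k y + y * bessel_series (Suc (Suc k)) y = (real k + 1) * bessel_series (Suc k) y"
proof -
  have s: "summable (\<lambda>j. bessel_coeff m j * y ^ Suc j)" for m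
    using summable_mult[OF summable_bessel_series[of m y], of y] by (simp add: mult_ac)
  have "(\<Sum>j. bessel_coeff (Suc k) j * y ^ j) =
      bessel_coeff (Suc k) 0 + (\<Sum>j. bessel_coeff (Suc k) (Suc j) * y ^ Suc j)"
    using suminf_split_head[OF summable_bessel_series[of "Suc k" y]] by simp
  moreover have "(\<Sum>j. bessel_coeff k j * y ^ j) =
      bessel_coeff k 0 + (\<Sum>j. bessel_coeff k (Suc j) * y ^ Suc j)"
    using suminf_split_head[OF summable_bessel_series[of k y]] by simp
  moreover have "y * bessel_series (Suc (Suc k)) y = (\<Sum>j. bessel_coeff (Suc (Suc k)) j * y ^ Suc j)"
    unfolding bessel_series_def
    using suminf_mult[OF summable_bessel_series[of "Suc (Suc k)" y], of y] by (simp add: mult_ac)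
  moreover have "(\<Sum>j. bessel_coeff k (Suc j) * y ^ Suc j) + (\<Sum>j. bessel_coeff (Suc (Suc k)) j * y ^ Suc j)
     = (real k + 1) * (\<Sum>j. bessel_coeff (Suc k) (Suc j) * y ^ Suc j)"
  proof -
    \<comment> \<open>After the common factors are taken out, (j + k + 2) - (j + 1) = k + 1 remains;
      these two numbers are \<open>b\<close> and \<open>a\<close> in \<open>*\<close>. The indices
      differ by one because the factor \<open>y\<close> shifts the series of order k + 2.\<close>
    have e: "bessel_coeff k (Suc j) + bessel_coeff (Suc (Suc k)) j
        = (real k + 1) * bessel_coeff (Suc k) (Suc j)" for j
    proof -
      have *: "- (u / (a * f * F)) + u / (f * (b * F)) = (b - a) * (- (u / (a * f * (b * F))))"
        if "a \<noteq> 0" "b \<noteq> 0" "f \<noteq> 0" "F \<noteq> 0" for a b f F u :: real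
        using that by (simp add: field_simps)
      have f: "fact (Suc j + k) = (fact (j + Suc k) :: real)"
        "fact (j + Suc (Suc k)) = real (Suc (j + Suc k)) * fact (j + Suc k)"
        "fact (Suc j + Suc k) = real (Suc (j + Suc k)) * fact (j + Suc k)"
        by (simp_all only: add_Suc add_Suc_right fact_Suc)
      show ?thesis
        using *[of "real (Suc j)" "real (Suc (j + Suc k))" "fact j" "fact (j + Suc k)" "(-1) ^ j"]
        unfolding bessel_coeff_def f fact_Suc[of j] by simp
    qed
    have "(\<Sum>j. bessel_coeff k (Suc j) * y ^ Suc j) + (\<Sum>j. bessel_coeff (Suc (Suc k)) j * y ^ Suc j)
      = (\<Sum>j. bessel_coeff k (Suc j) * y ^ Suc j + bessel_coeff (Suc (Suc k)) j * y ^ Suc j)"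
      by (intro suminf_add s summable_Suc_iff[THEN iffD2, OF summable_bessel_series])
    also have "\<dots> = (\<Sum>j. (real k + 1) * (bessel_coeff (Suc k) (Suc j) * y ^ Suc j))"
      by (intro suminf_cong) (simp only: distrib_right[symmetric] e mult.assoc)
    also have "\<dots> = (real k + 1) * (\<Sum>j. bessel_coeff (Suc k) (Suc j) * y ^ Suc j)"
      by (rule suminf_mult[OF summable_Suc_iff[THEN iffD2, OF summable_bessel_series]])
    finally show ?thesis .
  qed
  moreover have "bessel_coeff k 0 = (real k + 1) * bessel_coeff (Suc k) 0"
    using of_nat_neq_0[of k, where 'a = real] by (simp add: bessel_coeff_def fact_Suc divide_simps)
  ultimately show ?thesis
    unfolding bessel_series_def[of k] bessel_series_def[of "Suc k"] by (simp add: algebra_simps)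
qed

lemma besselJ_nat_series: "besselJ_nat k (2 * t) = t ^ k * bessel_series k (t\<^sup>2)"
proof -
  have "t ^ k * bessel_series k (t\<^sup>2) = (\<Sum>j. t ^ k * (bessel_coeff k j * (t\<^sup>2) ^ j))"
    unfolding bessel_series_def by (rule suminf_mult[OF summable_bessel_series, symmetric])
  also have "\<dots> = besselJ_nat k (2 * t)"
    unfolding besselJ_nat_def
    by (intro suminf_cong) (simp add: bessel_coeff_def power_add mult_ac flip: power_mult)
  finally show ?thesis ..
qed

lemma besselJ_nat_rec:
  "t * (besselJ_nat k (2 * t) + besselJ_nat (Suc (Suc k)) (2 * t))
    = (real k + 1) * besselJ_nat (Suc k) (2 * t)"
proof -
  have "t * (besselJ_nat k (2 * t) + besselJ_nat (Suc (Suc k)) (2 * t)) =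
      t ^ Suc k * (bessel_series k (t\<^sup>2) + t\<^sup>2 * bessel_series (Suc (Suc k)) (t\<^sup>2))"
    unfolding besselJ_nat_series by (simp add: algebra_simps power2_eq_square)
  then show ?thesis
    unfolding bessel_series_rec besselJ_nat_series by (simp add: algebra_simps)
qed

lemma besselJ_nat_0_deriv:
  "((\<lambda>t. besselJ_nat 0 (2 * t)) has_real_derivative - 2 * besselJ_nat 1 (2 * t)) (at t)"
proof -
  have "((\<lambda>t. bessel_series 0 (t\<^sup>2)) has_real_derivative - bessel_series (Suc 0) (t\<^sup>2) * (2 * t)) (at t)"
    by (rule DERIV_chain2[OF bessel_series_deriv]) (auto intro!: derivative_eq_intros)
  then show ?thesis
    unfolding besselJ_nat_series by (simp add: mult_ac)
qed

text \<open>The product rule leaves (k + 1) times the series of order k + 1. The recurrence replaces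
  it by its two neighbours, one of which removes half of the other term. The argument 2t absorbs the
  usual factor 1/2.\<close>

lemma besselJ_nat_Suc_deriv:
  "((\<lambda>t. besselJ_nat (Suc k) (2 * t)) has_real_derivative
     besselJ_nat k (2 * t) - besselJ_nat (Suc (Suc k)) (2 * t)) (at t)"
proof -
  have "((\<lambda>t. t ^ Suc k * bessel_series (Suc k) (t\<^sup>2)) has_real_derivative
     t ^ k * ((real k + 1) * bessel_series (Suc k) (t\<^sup>2))
      - 2 * t ^ Suc (Suc k) * bessel_series (Suc (Suc k)) (t\<^sup>2)) (at t)"
    by (rule derivative_eq_intros DERIV_chain2[OF bessel_series_deriv] refl)+
      (simp add: algebra_simps)
  then show ?thesis
    unfolding besselJ_nat_series bessel_series_rec[symmetric]
    by (simp add: algebra_simps power2_eq_square)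
qed

lemma besselJ_int_minus: "besselJ_int (- k) x = (-1) ^ nat \<bar>k\<bar> * besselJ_int k x"
  by (auto simp: besselJ_int_def power_mult_distrib[symmetric] mult.assoc[symmetric])

lemma besselJ_int_rec_deriv_nonneg:
  fixes t :: real
  assumes "k \<ge> 0"
  shows "t * (besselJ_int (k - 1) (2 * t) + besselJ_int (k + 1) (2 * t)) = of_int k * besselJ_int k (2 * t)"
    and "((\<lambda>t. besselJ_int k (2 * t)) has_real_derivative
           besselJ_int (k - 1) (2 * t) - besselJ_int (k + 1) (2 * t)) (at t)"
proof -
  consider "k = 0" | n where "k = int n + 1"
    using assms by (metis add.commute nonneg_int_cases not0_implies_Suc of_nat_0 of_nat_Suc)
  then have "t * (besselJ_int (k - 1) (2 * t) + besselJ_int (k + 1) (2 * t)) = of_int k * besselJ_int k (2 * t)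
    \<and> ((\<lambda>t. besselJ_int k (2 * t)) has_real_derivative
           besselJ_int (k - 1) (2 * t) - besselJ_int (k + 1) (2 * t)) (at t)"
  proof cases
    case 1
    then show ?thesis
      using besselJ_nat_0_deriv[of t] by (simp add: besselJ_int_def)
  next
    case 2
    have n: "nat (int n + 1) = Suc n" "nat (int n + 1 + 1) = Suc (Suc n)" by auto
    show ?thesis
      using besselJ_nat_Suc_deriv[of n t] besselJ_nat_rec[of t n]
      unfolding 2 besselJ_int_def n by (simp add: n add_ac)
  qed
  then show "t * (besselJ_int (k - 1) (2 * t) + besselJ_int (k + 1) (2 * t)) = of_int k * besselJ_int k (2 * t)"
    and "((\<lambda>t. besselJ_int k (2 * t)) has_real_derivative
           besselJ_int (k - 1) (2 * t) - besselJ_int (k + 1) (2 * t)) (at t)"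
    by auto
qed

text \<open>For negative orders J_{-k} = (-1)^k J_k exchanges the two neighbours. The extra sign of
  the middle order is matched by the sign of \<open>k\<close> in the recurrence and by the reversed
  difference in the derivative.\<close>

lemma besselJ_int_rec_deriv:
  fixes t :: real
  shows "t * (besselJ_int (k - 1) (2 * t) + besselJ_int (k + 1) (2 * t)) = of_int k * besselJ_int k (2 * t)"
    and "((\<lambda>t. besselJ_int k (2 * t)) has_real_derivative
           besselJ_int (k - 1) (2 * t) - besselJ_int (k + 1) (2 * t)) (at t)"
proof -
  have "t * (besselJ_int (k - 1) (2 * t) + besselJ_int (k + 1) (2 * t)) = of_int k * besselJ_int k (2 * t)
    \<and> ((\<lambda>t. besselJ_int k (2 * t)) has_real_derivative
           besselJ_int (k - 1) (2 * t) - besselJ_int (k + 1) (2 * t)) (at t)"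
  proof (cases "k \<ge> 0")
    case True
    then show ?thesis using besselJ_int_rec_deriv_nonneg by blast
  next
    case False
    define n where "n = nat (- k - 1)"
    have k: "k = - (int n + 1)" using False by (auto simp: n_def)
    have m: "besselJ_int k x = (-1) ^ Suc n * besselJ_int (int n + 1) x"
      "besselJ_int (k + 1) x = (-1) ^ n * besselJ_int (int n) x"
      "besselJ_int (k - 1) x = (-1) ^ n * besselJ_int (int n + 2) x" for x
      using besselJ_int_minus[of "int n + 1" x] besselJ_int_minus[of "int n" x]
        besselJ_int_minus[of "int n + 2" x]
      by (simp_all add: k nat_add_distrib abs_if add.commute minus_diff_commute)
    have r: "t * (besselJ_int (int n) (2 * t) + besselJ_int (int n + 2) (2 * t))
        = (real n + 1) * besselJ_int (int n + 1) (2 * t)"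
      using besselJ_int_rec_deriv_nonneg(1)[of "int n + 1" t] by (simp add: add.assoc)
    have "t * (besselJ_int (k - 1) (2 * t) + besselJ_int (k + 1) (2 * t))
        = (-1) ^ n * (t * (besselJ_int (int n) (2 * t) + besselJ_int (int n + 2) (2 * t)))"
      unfolding m by (simp add: algebra_simps)
    also have "\<dots> = of_int k * besselJ_int k (2 * t)"
    proof -
      have *: "of_int k = - (real n + 1)" by (simp add: k)
      show ?thesis unfolding r m(1) * by (simp add: algebra_simps)
    qed
    finally have 1: "t * (besselJ_int (k - 1) (2 * t) + besselJ_int (k + 1) (2 * t))
        = of_int k * besselJ_int k (2 * t)" .
    have d: "((\<lambda>t. besselJ_int (int n + 1) (2 * t)) has_real_derivative
           besselJ_int (int n) (2 * t) - besselJ_int (int n + 2) (2 * t)) (at t)"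
      using besselJ_int_rec_deriv_nonneg(2)[of "int n + 1" t] by (simp add: add.assoc)
    have "((\<lambda>t. besselJ_int k (2 * t)) has_real_derivative
           besselJ_int (k - 1) (2 * t) - besselJ_int (k + 1) (2 * t)) (at t)"
      unfolding m by (rule DERIV_cong[OF DERIV_cmult[OF d]]) (simp add: algebra_simps)
    with 1 show ?thesis by blast
  qed
  then show "t * (besselJ_int (k - 1) (2 * t) + besselJ_int (k + 1) (2 * t)) = of_int k * besselJ_int k (2 * t)"
    and "((\<lambda>t. besselJ_int k (2 * t)) has_real_derivative
           besselJ_int (k - 1) (2 * t) - besselJ_int (k + 1) (2 * t)) (at t)"
    by auto
qed

lemma besselJ_rec:
  "t * (besselJ (a - 1) (2 * t) + besselJ (a + 1) (2 * t)) = a * besselJ a (2 * t)" if "a \<in> \<int>"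
  using besselJ_int_rec_deriv(1)[of t "\<lfloor>a\<rfloor>"] that
  by (auto simp: besselJ_def elim!: Ints_cases)

lemma besselJ_deriv:
  "((\<lambda>t. besselJ a (2 * t)) has_real_derivative besselJ (a - 1) (2 * t) - besselJ (a + 1) (2 * t)) (at t)"
  using besselJ_int_rec_deriv(2)[of "\<lfloor>a\<rfloor>" t] by (simp add: besselJ_def)

section \<open>Geometric decay in the order, locally uniform in the argument\<close>

definition geom_weight :: "real \<Rightarrow> real" where
  "geom_weight a = (1/2) ^ nat \<bar>\<lfloor>a\<rfloor>\<bar>"

lemma geom_weight_pos: "geom_weight a > 0"
  by (simp add: geom_weight_def)

lemma geom_weight_le_1: "geom_weight a \<le> 1"
  by (simp add: geom_weight_def power_le_one)

text \<open>A single term of the exponential series bounds (2r)^k / k! by exp(2r). This trades the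
  factorial for the ratio 1/2, a rate that is easy to handle under translations of the
  order.\<close>

lemma besselJ_nat_bound:
  assumes "\<bar>t\<bar> \<le> r"
  shows "\<bar>besselJ_nat k (2 * t)\<bar> \<le> exp (2 * r + r\<^sup>2) * (1/2) ^ k"
proof -
  have r: "r \<ge> 0" using assms by linarith
  have "(2 * r) ^ k / fact k \<le> exp (2 * r)"
  proof -
    have s: "(\<lambda>j. (2 * r) ^ j / fact j) sums exp (2 * r)"
      using exp_converges[of "2 * r"] by (simp add: field_simps)
    have "(\<Sum>j\<in>{k}. (2 * r) ^ j / fact j) \<le> (\<Sum>j. (2 * r) ^ j / fact j)"
      by (rule sum_le_suminf[OF sums_summable[OF s]]) (use r in auto)
    then show ?thesis using sums_unique[OF s] by simp
  qed
  then have e: "r ^ k / fact k \<le> exp (2 * r) * (1/2) ^ k"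
    by (simp add: power_mult_distrib field_simps)
  have "\<bar>besselJ_nat k (2 * t)\<bar> = \<bar>t\<bar> ^ k * \<bar>bessel_series k (t\<^sup>2)\<bar>"
    by (simp add: besselJ_nat_series abs_mult power_abs)
  also have "\<dots> \<le> r ^ k * (exp (r\<^sup>2) / fact k)"
  proof (intro mult_mono power_mono assms)
    have "t\<^sup>2 \<le> r\<^sup>2" using assms by (simp add: abs_le_square_iff[symmetric])
    then show "\<bar>bessel_series k (t\<^sup>2)\<bar> \<le> exp (r\<^sup>2) / fact k"
      using bessel_series_bound[of k "t\<^sup>2"] by (simp add: divide_le_cancel order_trans[OF bessel_series_bound])
  qed (use r in auto)
  also have "\<dots> = exp (r\<^sup>2) * (r ^ k / fact k)" by simp
  also have "\<dots> \<le> exp (r\<^sup>2) * (exp (2 * r) * (1/2) ^ k)"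
    by (intro mult_left_mono e) auto
  finally show ?thesis by (simp add: exp_add mult_ac)
qed

lemma besselJ_bound:
  assumes "\<bar>t\<bar> \<le> r"
  shows "\<bar>besselJ a (2 * t)\<bar> \<le> exp (2 * r + r\<^sup>2) * geom_weight a"
proof (cases "\<lfloor>a\<rfloor> \<ge> 0")
  case True
  then show ?thesis
    using besselJ_nat_bound[OF assms, of "nat \<lfloor>a\<rfloor>"]
    unfolding besselJ_def besselJ_int_def geom_weight_def by (simp only: if_True abs_of_nonneg)
next
  case False
  then have "\<bar>\<lfloor>a\<rfloor>\<bar> = - \<lfloor>a\<rfloor>" by linarith
  with False show ?thesis
    using besselJ_nat_bound[OF assms, of "nat (- \<lfloor>a\<rfloor>)"]
    unfolding besselJ_def besselJ_int_def geom_weight_def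
    by (simp only: if_False abs_mult power_abs abs_minus_cancel abs_one power_one mult_1)
qed

lemma sum_half_power_le: "finite F \<Longrightarrow> (\<Sum>n\<in>F. (1/2) ^ n) \<le> (2::real)"
  using sum_le_suminf[of "\<lambda>n. (1/2::real) ^ n" F] by (simp add: suminf_geometric summable_geometric)

text \<open>One geometric series, of sum at most 2, for each sign of \<open>k\<close>.\<close>

lemma sum_int_half_power_le:
  assumes "finite F"
  shows "(\<Sum>k\<in>F. (1/2::real) ^ nat \<bar>k\<bar>) \<le> 4"
proof -
  have "(\<Sum>k\<in>F. (1/2::real) ^ nat \<bar>k\<bar>) =
      (\<Sum>k\<in>{k\<in>F. k \<ge> 0}. (1/2) ^ nat \<bar>k\<bar>) + (\<Sum>k\<in>{k\<in>F. k < 0}. (1/2) ^ nat \<bar>k\<bar>)"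
    using assms by (subst sum.union_disjoint[symmetric]) (auto intro!: sum.cong)
  also have "(\<Sum>k\<in>{k\<in>F. k \<ge> 0}. (1/2::real) ^ nat \<bar>k\<bar>) = (\<Sum>n\<in>(\<lambda>k. nat \<bar>k\<bar>) ` {k\<in>F. k \<ge> 0}. (1/2) ^ n)"
    by (subst sum.reindex) (auto simp: inj_on_def)
  also have "\<dots> \<le> 2" by (rule sum_half_power_le) (use assms in auto)
  also have "(\<Sum>k\<in>{k\<in>F. k < 0}. (1/2::real) ^ nat \<bar>k\<bar>) = (\<Sum>n\<in>(\<lambda>k. nat \<bar>k\<bar>) ` {k\<in>F. k < 0}. (1/2) ^ n)"
    by (subst sum.reindex) (auto simp: inj_on_def)
  also have "\<dots> \<le> 2" by (rule sum_half_power_le) (use assms in auto)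
  finally show ?thesis by simp
qed

lemma sum_geom_weight_le:
  assumes "finite F" "F \<subseteq> \<int>"
  shows "(\<Sum>a\<in>F. geom_weight a) \<le> 4"
proof -
  have inj: "inj_on floor F"
  proof (rule inj_onI)
    fix x y assume "x \<in> F" "y \<in> F" "\<lfloor>x\<rfloor> = \<lfloor>y\<rfloor>"
    moreover from this have "x \<in> \<int>" "y \<in> \<int>" using assms(2) by auto
    ultimately show "x = y" by (auto elim!: Ints_cases)
  qed
  have "(\<Sum>a\<in>F. geom_weight a) = (\<Sum>k\<in>floor ` F. (1/2) ^ nat \<bar>k\<bar>)"
    by (simp add: sum.reindex[OF inj] geom_weight_def)
  also have "\<dots> \<le> 4" using assms by (intro sum_int_half_power_le) auto
  finally show ?thesis .
qed

section \<open>The equation for finite matrices\<close>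

lemma permutes_lt: "p permutes {0..<m} \<Longrightarrow> i < m \<Longrightarrow> p i < (m::nat)"
  using permutes_in_image[of p "{0..<m}" i] by simp

text \<open>Jacobi's formula: differentiate one row at a time and expand along that row, whose
  cofactors do not see it.\<close>

lemma has_real_derivative_det:
  fixes A :: "real \<Rightarrow> nat \<Rightarrow> nat \<Rightarrow> real"
  assumes "\<And>i j. i < m \<Longrightarrow> j < m \<Longrightarrow> ((\<lambda>t. A t i j) has_real_derivative A' i j) (at x)"
  shows "((\<lambda>t. Determinant.det (Matrix.mat m m (\<lambda>(i, j). A t i j))) has_real_derivative
    (\<Sum>i<m. \<Sum>j<m. A' i j * cofactor (Matrix.mat m m (\<lambda>(i, j). A x i j)) i j)) (at x)"
proof -
  let ?M = "\<lambda>t. Matrix.mat m m (\<lambda>(i, j). A t i j)"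
  let ?R = "\<lambda>k. Matrix.mat m m (\<lambda>(i, j). if i = k then A' i j else A x i j)"
  have det: "Determinant.det (?M t) = (\<Sum>p | p permutes {0..<m}. signof p * (\<Prod>i = 0..<m. A t i (p i)))" for t
    by (subst det_def'[of _ m]) (auto intro!: sum.cong prod.cong simp: permutes_lt)
  have "((\<lambda>t. Determinant.det (?M t)) has_real_derivative
      (\<Sum>p | p permutes {0..<m}. signof p *
        (\<Sum>k = 0..<m. A' k (p k) * (\<Prod>i\<in>{0..<m} - {k}. A x i (p i))))) (at x)"
    unfolding det
    by (intro DERIV_sum DERIV_cmult has_field_derivative_prod assms) (auto simp: permutes_lt)
  also have "(\<Sum>p | p permutes {0..<m}. signof p *
        (\<Sum>k = 0..<m. A' k (p k) * (\<Prod>i\<in>{0..<m} - {k}. A x i (p i))))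
      = (\<Sum>k = 0..<m. \<Sum>p | p permutes {0..<m}. signof p *
          (A' k (p k) * (\<Prod>i\<in>{0..<m} - {k}. A x i (p i))))"
    by (subst sum.swap) (simp add: sum_distrib_left)
  also have "\<dots> = (\<Sum>k = 0..<m. Determinant.det (?R k))"
  proof (rule sum.cong[OF refl])
    fix k assume k: "k \<in> {0..<m}"
    show "(\<Sum>p | p permutes {0..<m}. signof p * (A' k (p k) * (\<Prod>i\<in>{0..<m} - {k}. A x i (p i))))
        = Determinant.det (?R k)"
    proof (subst det_def'[of _ m], simp, intro sum.cong refl arg_cong2[of _ _ _ _ "(*)"])
      fix p assume p: "p \<in> {p. p permutes {0..<m}}"
      have "(\<Prod>i = 0..<m. ?R k $$ (i, p i)) = ?R k $$ (k, p k) * (\<Prod>i\<in>{0..<m} - {k}. ?R k $$ (i, p i))"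
        using k by (intro prod.remove) auto
      also have "?R k $$ (k, p k) = A' k (p k)" using k p by (simp add: permutes_lt)
      also have "(\<Prod>i\<in>{0..<m} - {k}. ?R k $$ (i, p i)) = (\<Prod>i\<in>{0..<m} - {k}. A x i (p i))"
        using p by (intro prod.cong) (auto simp: permutes_lt)
      finally show "A' k (p k) * (\<Prod>i\<in>{0..<m} - {k}. A x i (p i)) = (\<Prod>i = 0..<m. ?R k $$ (i, p i))" ..
    qed
  qed
  also have "\<dots> = (\<Sum>k<m. \<Sum>j<m. A' k j * cofactor (?M x) k j)"
  proof (rule sum.cong)
    fix k assume k: "k \<in> {..<m}"
    have "Determinant.det (?R k) = (\<Sum>j<m. ?R k $$ (k, j) * cofactor (?R k) k j)"
      using k by (intro laplace_expansion_row[of _ m]) auto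
    also have "\<dots> = (\<Sum>j<m. A' k j * cofactor (?M x) k j)"
    proof (intro sum.cong refl arg_cong2[of _ _ _ _ "(*)"])
      fix j assume j: "j \<in> {..<m}"
      show "?R k $$ (k, j) = A' k j" using j k by simp
      have "mat_delete (?R k) k j = mat_delete (?M x) k j"
        unfolding mat_delete_def by (rule eq_matI) auto
      then show "cofactor (?R k) k j = cofactor (?M x) k j" by (simp add: cofactor_def)
    qed
    finally show "Determinant.det (?R k) = (\<Sum>j<m. A' k j * cofactor (?M x) k j)" .
  qed auto
  finally show ?thesis .
qed

text \<open>Existence is the point: by Cramer's rule it makes the entries of the inverse
  differentiable, and their derivative is then read off from R A = 1.\<close>

lemma differentiable_cofactor:
  fixes A :: "real \<Rightarrow> nat \<Rightarrow> nat \<Rightarrow> real"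
  assumes "\<And>i j. i < m \<Longrightarrow> j < m \<Longrightarrow> ((\<lambda>t. A t i j) has_real_derivative A' i j) (at x)"
    and "k < m" "l < m"
  shows "\<exists>D. ((\<lambda>t. cofactor (Matrix.mat m m (\<lambda>(i, j). A t i j)) k l) has_real_derivative D) (at x)"
proof -
  define f where "f k i = (if i < k then i else Suc i)" for k i :: nat
  have d: "mat_delete (Matrix.mat m m (\<lambda>(i, j). A t i j)) k l
      = Matrix.mat (m - 1) (m - 1) (\<lambda>(i, j). A t (f k i) (f l j))" for t
    unfolding mat_delete_def f_def using assms(2,3) by (intro eq_matI) auto
  have "f k i < m" if "i < m - 1" for k i using that by (auto simp: f_def)
  then have E: "((\<lambda>t. Determinant.det (Matrix.mat (m - 1) (m - 1) (\<lambda>(i, j). A t (f k i) (f l j)))) has_real_derivative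
    (\<Sum>i<m - 1. \<Sum>j<m - 1. A' (f k i) (f l j) *
       cofactor (Matrix.mat (m - 1) (m - 1) (\<lambda>(i, j). A x (f k i) (f l j))) i j)) (at x)"
    by (intro has_real_derivative_det assms(1)) auto
  show ?thesis
    unfolding cofactor_def d by (rule exI, rule DERIV_cmult, rule E)
qed

text \<open>The matrix determinant lemma, with \<open>R\<close> the inverse of \<open>A\<close>. The
  bordered matrix with rows (1, y) and (x, A) has two block triangular factorisations: one clears
  \<open>x\<close> by means of the entry 1 and leaves A - x y^T, the other clears it by means of
  \<open>A\<close>, using \<open>z\<close> with A z = x, and leaves 1 - y^T z.\<close>

lemma det_diff_rank_one:
  fixes A R :: "nat \<Rightarrow> nat \<Rightarrow> real"
  assumes R: "\<And>i j. i < m \<Longrightarrow> j < m \<Longrightarrow> (\<Sum>k<m. A i k * R k j) = (if i = j then 1 else 0)"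
  shows "Determinant.det (Matrix.mat m m (\<lambda>(i, j). A i j - x i * y j))
    = Determinant.det (Matrix.mat m m (\<lambda>(i, j). A i j)) * (1 - (\<Sum>i<m. \<Sum>j<m. y i * R i j * x j))"
proof -
  let ?A = "Matrix.mat m m (\<lambda>(i, j). A i j)"
  let ?D = "Matrix.mat m m (\<lambda>(i, j). A i j - x i * y j)"
  define z where "z i = (\<Sum>j<m. R i j * x j)" for i
  have Az: "(\<Sum>k<m. A i k * z k) = x i" if "i < m" for i
  proof -
    have "(\<Sum>k<m. A i k * z k) = (\<Sum>j<m. (\<Sum>k<m. A i k * R k j) * x j)"
      unfolding z_def sum_distrib_left sum_distrib_right by (subst sum.swap) (simp add: mult_ac)
    also have "\<dots> = (\<Sum>j<m. (if i = j then 1 else 0) * x j)"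
      using that by (intro sum.cong) (auto simp: R)
    also have "\<dots> = x i" using that by (simp add: if_distrib[of "\<lambda>c. c * _"] cong: if_cong)
    finally show ?thesis .
  qed
  let ?I = "1\<^sub>m 1 :: real mat" and ?J = "1\<^sub>m m :: real mat"
  let ?y = "Matrix.mat 1 m (\<lambda>(i, j). y j)" and ?x = "Matrix.mat m 1 (\<lambda>(i, j). x i)"
  let ?z = "Matrix.mat m 1 (\<lambda>(i, j). z i)"
  let ?c = "Matrix.mat 1 1 (\<lambda>(i, j). 1 - (\<Sum>k<m. y k * z k))"
  let ?M = "four_block_mat ?I ?y ?x ?A"
  have c: "?I \<in> carrier_mat 1 1" "?J \<in> carrier_mat m m" "?y \<in> carrier_mat 1 m" "?x \<in> carrier_mat m 1"
    "?z \<in> carrier_mat m 1" "?c \<in> carrier_mat 1 1" "?A \<in> carrier_mat m m" "?D \<in> carrier_mat m m"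
    "0\<^sub>m 1 m \<in> carrier_mat 1 m" "0\<^sub>m m 1 \<in> carrier_mat m 1"
    by auto
  let ?L = "four_block_mat ?I (0\<^sub>m 1 m)"
  have car: "four_block_mat E F G H \<in> carrier_mat (1 + m) (1 + m)"
    if "E \<in> carrier_mat 1 1" "H \<in> carrier_mat m m" for E F G H :: "real mat"
    by (rule four_block_carrier_mat[OF that])
  have detL: "Determinant.det (?L V ?J) = 1" if "V \<in> carrier_mat m 1" for V
    using det_four_block_mat_upper_right_zero[OF c(1) refl that c(2)] by simp
  have "?L ?x ?J * four_block_mat ?I ?y (0\<^sub>m m 1) ?D = ?M"
  proof -
    have "?x * ?y + ?J * ?D = ?A"
      by (rule eq_matI) (auto simp: scalar_prod_def)
    then show ?thesis
      by (subst mult_four_block_mat[of _ 1 1 _ m _ m _ _ 1 _ m]) (auto simp: c)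
  qed
  then have "Determinant.det ?M = Determinant.det (?L ?x ?J) * Determinant.det (four_block_mat ?I ?y (0\<^sub>m m 1) ?D)"
    using det_mult[OF car[OF c(1,2)] car[OF c(1,8)]] by metis
  then have "Determinant.det ?M = Determinant.det ?D"
    unfolding detL[OF c(4)] det_four_block_mat_lower_left_zero[OF c(1,3) refl c(8)] by simp
  moreover have "four_block_mat ?c ?y (0\<^sub>m m 1) ?A * ?L ?z ?J = ?M"
  proof -
    have "?c * ?I + ?y * ?z = ?I"
      by (rule eq_matI) (auto simp: scalar_prod_def lessThan_atLeast0)
    moreover have "0\<^sub>m m 1 * ?I + ?A * ?z = ?x"
      by (rule eq_matI) (auto simp: scalar_prod_def Az[symmetric] lessThan_atLeast0)
    ultimately show ?thesis
      by (subst mult_four_block_mat[of _ 1 1 _ m _ m _ _ 1 _ m]) (auto simp: c)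
  qed
  then have "Determinant.det ?M = Determinant.det (four_block_mat ?c ?y (0\<^sub>m m 1) ?A) * Determinant.det (?L ?z ?J)"
    using det_mult[OF car[OF c(6,7)] car[OF c(1,2)]] by metis
  then have "Determinant.det ?M = Determinant.det ?c * Determinant.det ?A"
    unfolding detL[OF c(5)] det_four_block_mat_lower_left_zero[OF c(6,3) refl c(7)] by simp
  moreover have "Determinant.det ?c = 1 - (\<Sum>k<m. y k * z k)"
    by (subst det_single) auto
  ultimately show ?thesis
    by (simp add: z_def sum_distrib_left mult_ac)
qed

text \<open>The hypotheses isolate what is used of B_s: a symmetric family with this derivative and
  this commutator, and vectors solving a first-order system. No property of Bessel functions enters
  beyond them.\<close>

lemma toda_finite:
  fixes B :: "real \<Rightarrow> nat \<Rightarrow> nat \<Rightarrow> real" and p q :: "real \<Rightarrow> nat \<Rightarrow> real" and l :: "nat \<Rightarrow> real" and s :: real and m :: nat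
  defines "D \<equiv> \<lambda>t. Determinant.det (Matrix.mat m m (\<lambda>(i, j). (if i = j then 1 else 0) - B t i j))"
    and "Dm \<equiv> \<lambda>t. Determinant.det (Matrix.mat m m (\<lambda>(i, j). (if i = j then 1 else 0) - (B t i j + p t i * p t j)))"
    and "Dp \<equiv> \<lambda>t. Determinant.det (Matrix.mat m m (\<lambda>(i, j). (if i = j then 1 else 0) - (B t i j - q t i * q t j)))"
  assumes S: "open S" "\<And>t. t \<in> S \<Longrightarrow> t > 0" "\<And>t. t \<in> S \<Longrightarrow> D t > 0"
    and sym: "\<And>t i j. i < m \<Longrightarrow> j < m \<Longrightarrow> B t i j = B t j i"
    and comm: "\<And>t i j. t \<in> S \<Longrightarrow> i < m \<Longrightarrow> j < m \<Longrightarrow>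
      (l i - l j) * B t i j = t * (p t i * q t j - q t i * p t j)"
    and dB: "\<And>t i j. t \<in> S \<Longrightarrow> i < m \<Longrightarrow> j < m \<Longrightarrow>
      ((\<lambda>t. B t i j) has_real_derivative p t i * q t j + q t i * p t j) (at t)"
    and dp: "\<And>t i. t \<in> S \<Longrightarrow> i < m \<Longrightarrow>
      ((\<lambda>t. p t i) has_real_derivative (s + l i) / t * p t i - 2 * q t i) (at t)"
    and dq: "\<And>t i. t \<in> S \<Longrightarrow> i < m \<Longrightarrow>
      ((\<lambda>t. q t i) has_real_derivative 2 * p t i - (s + 1 + l i) / t * q t i) (at t)"
  shows "\<exists>f'. \<forall>t\<in>S. ((\<lambda>t. ln (D t)) has_real_derivative f' t) (at t) \<and>
    (f' has_real_derivative 4 * (Dp t * Dm t / (D t)\<^sup>2) - 4 - f' t / t) (at t)"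
proof -
  define A where "A t i j = (if i = j then 1 else 0) - B t i j" for t i j
  let ?M = "\<lambda>t. Matrix.mat m m (\<lambda>(i, j). A t i j)"
  define R where "R t i j = cofactor (?M t) j i / D t" for t i j
  have D: "D t = Determinant.det (?M t)" for t
    by (simp add: D_def A_def)
  then have D_fun: "D = (\<lambda>t. Determinant.det (?M t))"
    by blast
  have dA: "((\<lambda>t. A t i j) has_real_derivative - (p t i * q t j + q t i * p t j)) (at t)"
    if "t \<in> S" "i < m" "j < m" for t i j
    unfolding A_def by (auto intro!: derivative_eq_intros dB that)
  have AR: "(\<Sum>k<m. A t i k * R t k j) = (if i = j then 1 else 0)"
    and RA: "(\<Sum>k<m. R t i k * A t k j) = (if i = j then 1 else 0)"
    if "t \<in> S" "i < m" "j < m" for t i j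
  proof -
    have M: "?M t \<in> carrier_mat m m" by simp
    have "(?M t * adj_mat (?M t)) $$ (i, j) = (D t \<cdot>\<^sub>m 1\<^sub>m m) $$ (i, j)"
      by (simp add: adj_mat(2)[OF M] D)
    then have "(\<Sum>k<m. A t i k * cofactor (?M t) j k) = (if i = j then D t else 0)"
      using that by (simp add: adj_mat_def scalar_prod_def lessThan_atLeast0 cong: if_cong)
    then show "(\<Sum>k<m. A t i k * R t k j) = (if i = j then 1 else 0)"
      using S(3)[OF that(1)] by (simp add: R_def sum_divide_distrib[symmetric])
    have "(adj_mat (?M t) * ?M t) $$ (i, j) = (D t \<cdot>\<^sub>m 1\<^sub>m m) $$ (i, j)"
      by (simp add: adj_mat(3)[OF M] D)
    then have "(\<Sum>k<m. cofactor (?M t) k i * A t k j) = (if i = j then D t else 0)"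
      using that by (simp add: adj_mat_def scalar_prod_def lessThan_atLeast0 cong: if_cong)
    then show "(\<Sum>k<m. R t i k * A t k j) = (if i = j then 1 else 0)"
      using S(3)[OF that(1)] by (simp add: R_def sum_divide_distrib[symmetric])
  qed
  have symA: "A t i j = A t j i" if "i < m" "j < m" for t i j
    using sym[OF that] by (auto simp: A_def)
  \<comment> \<open>For the diagonal matrix F of \<open>f\<close> these read R F A R = R F and R A F
    R = F R. With f = l their difference is the commutator of \<open>R\<close> with multiplication
    by l.\<close>
  have sandwich: "(\<Sum>k<m. \<Sum>j<m. R t i k * (f k * A t k j) * R t j n) = R t i n * f n"
    "(\<Sum>k<m. \<Sum>j<m. R t i k * (A t k j * f j) * R t j n) = f i * R t i n"
    if "t \<in> S" "i < m" "n < m" for t i n and f :: "nat \<Rightarrow> real"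
  proof -
    have "(\<Sum>k<m. \<Sum>j<m. R t i k * (f k * A t k j) * R t j n)
        = (\<Sum>k<m. R t i k * f k * (\<Sum>j<m. A t k j * R t j n))"
      by (simp add: sum_distrib_left mult_ac)
    also have "\<dots> = (\<Sum>k<m. R t i k * f k * (if k = n then 1 else 0))"
      using that by (intro sum.cong) (auto simp: AR)
    finally show "(\<Sum>k<m. \<Sum>j<m. R t i k * (f k * A t k j) * R t j n) = R t i n * f n"
      using that by (simp add: if_distrib cong: if_cong)
    have "(\<Sum>k<m. \<Sum>j<m. R t i k * (A t k j * f j) * R t j n)
        = (\<Sum>j<m. (\<Sum>k<m. R t i k * A t k j) * (f j * R t j n))"
      by (subst sum.swap) (simp add: sum_distrib_left sum_distrib_right mult_ac)
    also have "\<dots> = (\<Sum>j<m. (if i = j then 1 else 0) * (f j * R t j n))"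
      using that by (intro sum.cong) (auto simp: RA)
    finally show "(\<Sum>k<m. \<Sum>j<m. R t i k * (A t k j * f j) * R t j n) = f i * R t i n"
      using that by (simp add: if_distrib[of "\<lambda>c. c * _"] cong: if_cong)
  qed
  have symR: "R t i j = R t j i" if "t \<in> S" "i < m" "j < m" for t i j
  proof -
    have "R t i j = (\<Sum>k<m. R t i k * (\<Sum>n<m. A t k n * R t j n))"
    proof -
      have "(\<Sum>n<m. A t k n * R t j n) = (if k = j then 1 else 0)" if "k < m" for k
      proof -
        have "(\<Sum>n<m. A t k n * R t j n) = (\<Sum>n<m. R t j n * A t n k)"
          using that symA by (intro sum.cong) (auto simp: mult.commute)
        then show ?thesis using RA[OF \<open>t \<in> S\<close> \<open>j < m\<close> that] by auto
      qed
      then have "(\<Sum>k<m. R t i k * (\<Sum>n<m. A t k n * R t j n)) = (\<Sum>k<m. R t i k * (if k = j then 1 else 0))"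
        by (intro sum.cong) auto
      then show ?thesis using that by (simp add: if_distrib cong: if_cong)
    qed
    also have "\<dots> = (\<Sum>n<m. (\<Sum>k<m. R t i k * A t k n) * R t j n)"
      unfolding sum_distrib_left sum_distrib_right by (subst sum.swap) (simp add: mult_ac)
    also have "\<dots> = (\<Sum>n<m. (if i = n then 1 else 0) * R t j n)"
      using that by (intro sum.cong) (auto simp: RA)
    also have "\<dots> = R t j i" using that by (simp add: if_distrib[of "\<lambda>c. c * _"] cong: if_cong)
    finally show ?thesis .
  qed
  define P where "P t i = (\<Sum>k<m. R t i k * p t k)" for t i
  define Q where "Q t i = (\<Sum>k<m. R t i k * q t k)" for t i
  have P': "(\<Sum>k<m. p t k * R t k i) = P t i" and Q': "(\<Sum>k<m. q t k * R t k i) = Q t i"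
    if "t \<in> S" "i < m" for t i
    using that symR unfolding P_def Q_def by (auto intro!: sum.cong simp: mult.commute)
  have rank_one: "(\<Sum>k<m. \<Sum>j<m. R t i k * (f k * g j) * R t j n)
      = (\<Sum>k<m. R t i k * f k) * (\<Sum>j<m. g j * R t j n)" for t i n and f g :: "nat \<Rightarrow> real"
    by (simp add: sum_product mult_ac)
  \<comment> \<open>R [l, A] R = [R, l], and [l, A] = - [l, B] because the identity commutes with l.
    So the inverse inherits the integrable form, with P = R p and Q = R q in place of p and
    q.\<close>
  have commR: "(l i - l j) * R t i j = t * (P t i * Q t j - Q t i * P t j)"
    if "t \<in> S" "i < m" "j < m" for t i j
  proof -
    have "(\<Sum>k<m. \<Sum>n<m. R t i k * (l k * A t k n) * R t n j)
        - (\<Sum>k<m. \<Sum>n<m. R t i k * (A t k n * l n) * R t n j)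
        = (\<Sum>k<m. \<Sum>n<m. R t i k * ((l k - l n) * A t k n) * R t n j)"
      by (simp add: sum_subtractf[symmetric] algebra_simps)
    also have "\<dots> = (\<Sum>k<m. \<Sum>n<m. - t * (R t i k * (p t k * q t n) * R t n j)
        + t * (R t i k * (q t k * p t n) * R t n j))"
    proof (intro sum.cong refl)
      fix k n assume "k \<in> {..<m}" "n \<in> {..<m}"
      then have e: "(l k - l n) * A t k n = - (t * (p t k * q t n - q t k * p t n))"
        using comm[of t k n] that by (auto simp: A_def algebra_simps)
      show "R t i k * ((l k - l n) * A t k n) * R t n j
        = - t * (R t i k * (p t k * q t n) * R t n j) + t * (R t i k * (q t k * p t n) * R t n j)"
        unfolding e by (simp add: algebra_simps)
    qed
    also have "\<dots> = - t * (\<Sum>k<m. \<Sum>n<m. R t i k * (p t k * q t n) * R t n j)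
        + t * (\<Sum>k<m. \<Sum>n<m. R t i k * (q t k * p t n) * R t n j)"
      by (simp only: sum.distrib sum_distrib_left)
    also have "\<dots> = - t * (P t i * Q t j) + t * (Q t i * P t j)"
      unfolding rank_one using that P' Q' by (simp add: P_def Q_def)
    finally show ?thesis
      unfolding sandwich[OF that] by (simp add: algebra_simps)
  qed
  have dR: "((\<lambda>t. R t i j) has_real_derivative P t i * Q t j + Q t i * P t j) (at t)"
    if t: "t \<in> S" and "i < m" "j < m" for t i j
  proof -
    have "\<exists>R'. ((\<lambda>t. R t i j) has_real_derivative R') (at t)" if ij: "i < m" "j < m" for i j
    proof -
      obtain E where "((\<lambda>t. cofactor (?M t) j i) has_real_derivative E) (at t)"
        using differentiable_cofactor[where A = A, OF dA[OF t] ij(2,1)] by blast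
      moreover have "D t \<noteq> 0" using S(3)[OF t] by simp
      moreover have "(D has_real_derivative
          (\<Sum>i<m. \<Sum>j<m. - (p t i * q t j + q t i * p t j) * cofactor (?M t) i j)) (at t)"
        unfolding D_fun by (rule has_real_derivative_det[where A = A, OF dA[OF t]])
      ultimately show ?thesis
        unfolding R_def by (intro exI) (rule DERIV_divide)
    qed
    then obtain R' where R': "((\<lambda>t. R t i j) has_real_derivative R' i j) (at t)" if "i < m" "j < m" for i j
      by metis
    \<comment> \<open>Differentiating R A = 1 gives R' A = - R A'; multiplying by \<open>R\<close>
      from the right then determines R'.\<close>
    have RA': "(\<Sum>k<m. R' i k * A t k n) = (\<Sum>k<m. R t i k * (p t k * q t n + q t k * p t n))"
      if "i < m" "n < m" for i n
    proof -
      have "((\<lambda>t. \<Sum>k<m. R t i k * A t k n) has_real_derivative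
          (\<Sum>k<m. R' i k * A t k n + - (p t k * q t n + q t k * p t n) * R t i k)) (at t)"
        by (intro DERIV_sum DERIV_mult R' dA t) (use that in auto)
      moreover have "((\<lambda>t. \<Sum>k<m. R t i k * A t k n) has_real_derivative 0) (at t)"
        by (rule has_field_derivative_transform_within_open[where S = S and f = "\<lambda>_. if i = n then 1 else 0"])
          (use S(1) t that RA in auto)
      ultimately have "(\<Sum>k<m. R' i k * A t k n + - (p t k * q t n + q t k * p t n) * R t i k) = 0"
        by (rule DERIV_unique)
      then show ?thesis by (simp add: sum.distrib sum_subtractf algebra_simps)
    qed
    have "R' i j = (\<Sum>k<m. R' i k * (\<Sum>n<m. A t k n * R t n j))"
    proof -
      have "(\<Sum>k<m. R' i k * (\<Sum>n<m. A t k n * R t n j)) = (\<Sum>k<m. R' i k * (if k = j then 1 else 0))"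
        using that by (intro sum.cong) (auto simp: AR)
      then show ?thesis using that by (simp add: if_distrib cong: if_cong)
    qed
    also have "\<dots> = (\<Sum>n<m. (\<Sum>k<m. R' i k * A t k n) * R t n j)"
      unfolding sum_distrib_left sum_distrib_right by (subst sum.swap) (simp add: mult_ac)
    also have "\<dots> = (\<Sum>n<m. (\<Sum>k<m. R t i k * (p t k * q t n + q t k * p t n)) * R t n j)"
      using that by (intro sum.cong) (auto simp: RA')
    also have "\<dots> = (\<Sum>k<m. \<Sum>n<m. R t i k * (p t k * q t n) * R t n j)
        + (\<Sum>k<m. \<Sum>n<m. R t i k * (q t k * p t n) * R t n j)"
      unfolding sum_distrib_right
      by (subst sum.swap) (simp add: sum.distrib[symmetric] algebra_simps)
    also have "\<dots> = P t i * Q t j + Q t i * P t j"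
      unfolding rank_one using that P' Q' by (simp add: P_def Q_def)
    finally show ?thesis using R'[OF that(2,3)] by simp
  qed
  define u where "u t = (\<Sum>i<m. \<Sum>j<m. q t i * R t i j * p t j)" for t
  define \<alpha> where "\<alpha> t = (\<Sum>i<m. \<Sum>j<m. p t i * R t i j * p t j)" for t
  define \<beta> where "\<beta> t = (\<Sum>i<m. \<Sum>j<m. q t i * R t i j * q t j)" for t
  have Dm: "Dm t = D t * (1 - \<alpha> t)" if "t \<in> S" for t
  proof -
    have "Dm t = Determinant.det (Matrix.mat m m (\<lambda>(i, j). A t i j - p t i * p t j))"
      unfolding Dm_def A_def by (simp add: diff_diff_eq)
    then show ?thesis
      using det_diff_rank_one[where A = "A t", OF AR[OF that], of "p t" "p t"] by (simp add: D \<alpha>_def)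
  qed
  have Dp: "Dp t = D t * (1 + \<beta> t)" if "t \<in> S" for t
  proof -
    \<comment> \<open>The opposite sign of the rank-one term is absorbed into the left
      vector.\<close>
    have "Dp t = Determinant.det (Matrix.mat m m (\<lambda>(i, j). A t i j - - q t i * q t j))"
      unfolding Dp_def A_def by (simp add: diff_diff_eq2 diff_add_eq)
    then show ?thesis
      using det_diff_rank_one[where A = "A t", OF AR[OF that], of "\<lambda>i. - q t i" "q t"]
      by (simp add: D \<beta>_def sum_negf)
  qed
  have dlnD: "((\<lambda>t. ln (D t)) has_real_derivative - 2 * u t) (at t)" if t: "t \<in> S" for t
  proof -
    have "(D has_real_derivative
        (\<Sum>i<m. \<Sum>j<m. - (p t i * q t j + q t i * p t j) * cofactor (?M t) i j)) (at t)"
      unfolding D_fun by (rule has_real_derivative_det[where A = A, OF dA[OF t]])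
    moreover have "D t > 0" using S(3) t .
    ultimately have "((\<lambda>t. ln (D t)) has_real_derivative
        (\<Sum>i<m. \<Sum>j<m. - (p t i * q t j + q t i * p t j) * cofactor (?M t) i j) / D t) (at t)"
      by (auto intro!: derivative_eq_intros)
    also have "(\<Sum>i<m. \<Sum>j<m. - (p t i * q t j + q t i * p t j) * cofactor (?M t) i j) / D t
        = (\<Sum>i<m. \<Sum>j<m. - (p t i * q t j + q t i * p t j) * R t j i)"
      by (simp add: R_def sum_divide_distrib)
    also have "\<dots> = - (\<Sum>i<m. \<Sum>j<m. q t j * R t j i * p t i) - (\<Sum>i<m. \<Sum>j<m. q t i * R t j i * p t j)"
      by (simp add: sum_negf[symmetric] sum_subtractf[symmetric] algebra_simps)
    also have "(\<Sum>i<m. \<Sum>j<m. q t j * R t j i * p t i) = u t"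
      unfolding u_def by (rule sum.swap)
    also have "(\<Sum>i<m. \<Sum>j<m. q t i * R t j i * p t j) = u t"
      unfolding u_def using t symR by (intro sum.cong) auto
    finally show ?thesis by simp
  qed
  have du: "(u has_real_derivative 2 * \<alpha> t - 2 * \<beta> t - u t / t + 2 * (\<alpha> t * \<beta> t)) (at t)" if t: "t \<in> S" for t
  proof -
    have t0: "t > 0" using S(2) t .
    have "(u has_real_derivative (\<Sum>i<m. \<Sum>j<m.
        ((2 * p t i - (s + 1 + l i) / t * q t i) * R t i j + (P t i * Q t j + Q t i * P t j) * q t i) * p t j
        + ((s + l j) / t * p t j - 2 * q t j) * (q t i * R t i j))) (at t)"
      unfolding u_def[abs_def] by (intro DERIV_sum DERIV_mult dp dq dR t) auto
    also have "(\<Sum>i<m. \<Sum>j<m.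
        ((2 * p t i - (s + 1 + l i) / t * q t i) * R t i j + (P t i * Q t j + Q t i * P t j) * q t i) * p t j
        + ((s + l j) / t * p t j - 2 * q t j) * (q t i * R t i j))
      = (\<Sum>i<m. \<Sum>j<m. 2 * (p t i * R t i j * p t j) - 2 * (q t i * R t i j * q t j) - (q t i * R t i j * p t j) / t
         + 2 * ((q t i * Q t i) * (P t j * p t j)))"
    proof (intro sum.cong refl)
      fix i j assume ij: "i \<in> {..<m}" "j \<in> {..<m}"
      \<comment> \<open>In the summand the multiplications by l add up to -(1 + l_i - l_j)/t. The 1
        yields -u/t, and the difference is converted by \<open>commR\<close>. Among the terms in P
        and Q those with \<open>P t i * Q t j\<close>, which would sum to u^2, cancel, and those
        with \<open>Q t i * P t j\<close> double.\<close>
      have "(l i - l j) / t * R t i j = P t i * Q t j - Q t i * P t j"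
        using commR[OF t, of i j] ij t0 by (simp add: field_simps)
      then have e: "(l i / t) * R t i j = (l j / t) * R t i j + P t i * Q t j - Q t i * P t j"
        by (simp add: algebra_simps diff_divide_distrib)
      have "((2 * p t i - (s + 1 + l i) / t * q t i) * R t i j + (P t i * Q t j + Q t i * P t j) * q t i) * p t j
        + ((s + l j) / t * p t j - 2 * q t j) * (q t i * R t i j)
        = 2 * (p t i * R t i j * p t j) - 2 * (q t i * R t i j * q t j) - (q t i * R t i j * p t j) / t
          + (P t i * Q t j + Q t i * P t j) * q t i * p t j
          - ((l i / t) * R t i j - (l j / t) * R t i j) * q t i * p t j"
        by (simp add: algebra_simps add_divide_distrib)
      also have "\<dots> = 2 * (p t i * R t i j * p t j) - 2 * (q t i * R t i j * q t j) - (q t i * R t i j * p t j) / t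
         + 2 * ((q t i * Q t i) * (P t j * p t j))"
        unfolding e by (simp add: algebra_simps)
      finally show "((2 * p t i - (s + 1 + l i) / t * q t i) * R t i j + (P t i * Q t j + Q t i * P t j) * q t i) * p t j
        + ((s + l j) / t * p t j - 2 * q t j) * (q t i * R t i j) = \<dots>" .
    qed
    also have "\<dots> = 2 * \<alpha> t - 2 * \<beta> t - u t / t + 2 * ((\<Sum>i<m. q t i * Q t i) * (\<Sum>j<m. P t j * p t j))"
      unfolding \<alpha>_def \<beta>_def u_def sum_product
      by (simp only: sum.distrib sum_subtractf sum_distrib_left sum_divide_distrib)
    also have "(\<Sum>i<m. q t i * Q t i) = \<beta> t"
      unfolding \<beta>_def Q_def by (simp add: sum_distrib_left mult_ac)
    also have "(\<Sum>j<m. P t j * p t j) = \<alpha> t"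
      unfolding \<alpha>_def P_def by (simp add: sum_distrib_left sum_distrib_right mult_ac)
    finally show ?thesis by (simp add: mult.commute)
  qed
  show ?thesis
  proof (intro exI[of _ "\<lambda>t. - 2 * u t"] ballI conjI dlnD)
    fix t assume t: "t \<in> S"
    have "D t \<noteq> 0" using S(3)[OF t] by simp
    then have e: "Dp t * Dm t / (D t)\<^sup>2 = (1 + \<beta> t) * (1 - \<alpha> t)"
      by (simp add: Dm[OF t] Dp[OF t] power2_eq_square)
    show "((\<lambda>t. - 2 * u t) has_real_derivative
        4 * (Dp t * Dm t / (D t)\<^sup>2) - 4 - - 2 * u t / t) (at t)"
      unfolding e by (intro DERIV_cong[OF DERIV_cmult[OF du[OF t]]]) (simp add: algebra_simps)
  qed
qed

section \<open>Passing derivatives and the radial equation to a limit\<close>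

lemma has_real_derivative_uniform_limit:
  fixes f f' :: "nat \<Rightarrow> real \<Rightarrow> real"
  assumes S: "convex S" "open S"
    and df: "\<And>n x. x \<in> S \<Longrightarrow> (f n has_real_derivative f' n x) (at x)"
    and lim: "uniform_limit S f' F' sequentially"
    and f: "\<And>x. x \<in> S \<Longrightarrow> (\<lambda>n. f n x) \<longlonglongrightarrow> F x"
    and x: "x \<in> S"
  shows "(F has_real_derivative F' x) (at x)"
proof -
  \<comment> \<open>\<open>has_derivative_sequence\<close> delivers the limit as an unnamed
    function; uniqueness of pointwise limits identifies it with \<open>F\<close> below.\<close>
  have "\<exists>g. \<forall>y\<in>S. (\<lambda>n. f n y) \<longlonglongrightarrow> g y \<and> (g has_derivative (\<lambda>h. F' y * h)) (at y within S)"
  proof (rule has_derivative_sequence[where f = f and f' = "\<lambda>n y h. f' n y * h",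
        OF S(1) _ _ x f[OF x]])
    fix n y assume "y \<in> S"
    then show "(f n has_derivative (\<lambda>h. f' n y * h)) (at y within S)"
      using df by (metis has_derivative_at_withinI has_field_derivative_def)
  next
    fix e :: real assume "e > 0"
    then have "\<forall>\<^sub>F n in sequentially. \<forall>y\<in>S. dist (f' n y) (F' y) < e"
      using lim by (simp add: uniform_limit_iff)
    then show "\<forall>\<^sub>F n in sequentially. \<forall>y\<in>S. \<forall>h. norm (f' n y * h - F' y * h) \<le> e * norm h"
    proof eventually_elim
      case (elim n)
      show ?case
      proof (intro ballI allI)
        fix y h assume "y \<in> S"
        then have "\<bar>f' n y - F' y\<bar> * \<bar>h\<bar> \<le> e * \<bar>h\<bar>"
          using elim by (intro mult_right_mono) (auto simp: dist_real_def less_imp_le)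
        then show "norm (f' n y * h - F' y * h) \<le> e * norm h"
          by (simp add: left_diff_distrib[symmetric] abs_mult)
      qed
    qed
  qed
  then obtain g where g: "\<forall>y\<in>S. (\<lambda>n. f n y) \<longlonglongrightarrow> g y \<and> (g has_derivative (\<lambda>h. F' y * h)) (at y within S)" ..
  have "(g has_real_derivative F' x) (at x within S)"
    unfolding has_field_derivative_def using bspec[OF g x] by (rule conjunct2)
  then have "(g has_real_derivative F' x) (at x)"
    using at_within_open[OF x S(2)] by simp
  then show ?thesis
    by (rule has_field_derivative_transform_within_open[OF _ S(2) x])
      (metis LIMSEQ_unique g f)
qed

text \<open>No convergence of \<open>f'\<close> is assumed. Since t f' has derivative t h, the
  difference of t f' for two indices \<open>m\<close> and \<open>n\<close> varies little over the
  interval. The mean value theorem provides a point where it is small, because \<open>f\<close>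
  converges at two fixed points. Hence \<open>f'\<close> is uniformly Cauchy.\<close>

lemma radial_ode_limit:
  fixes f f' h :: "nat \<Rightarrow> real \<Rightarrow> real" and a b :: real
  assumes ab: "0 < a" "a < b"
    and df: "\<And>n t. t \<in> {a<..<b} \<Longrightarrow> (f n has_real_derivative f' n t) (at t)"
    and df': "\<And>n t. t \<in> {a<..<b} \<Longrightarrow> (f' n has_real_derivative h n t - f' n t / t) (at t)"
    and f: "\<And>t. t \<in> {a<..<b} \<Longrightarrow> (\<lambda>n. f n t) \<longlonglongrightarrow> F t"
    and h: "uniform_limit {a<..<b} h H sequentially"
  shows "\<exists>F'. \<forall>t\<in>{a<..<b}. (F has_real_derivative F' t) (at t) \<and>
    (F' has_real_derivative H t - F' t / t) (at t)"
proof -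
  let ?S = "{a<..<b}"
  define g where "g n t = t * f' n t" for n t
  have dg: "(g n has_real_derivative t * h n t) (at t)" if "t \<in> ?S" for n t
  proof -
    have "(g n has_real_derivative 1 * f' n t + (h n t - f' n t / t) * t) (at t)"
      unfolding g_def[abs_def] by (intro DERIV_mult DERIV_ident df' that)
    then show ?thesis using that ab by (simp add: algebra_simps)
  qed
  \<comment> \<open>Two fixed interior points, so that the length \<open>d - c\<close> in the mean
    value theorem is independent of \<open>m\<close> and \<open>n\<close>.\<close>
  define c d where "c = (2 * a + b) / 3" and "d = (a + 2 * b) / 3"
  have cd: "c \<in> ?S" "d \<in> ?S" "c < d" using ab by (auto simp: c_def d_def)
  \<comment> \<open>The first term bounds the difference of t f' at the mean value point, where t <
    b. The second bounds its variation from there: slope at most b \<epsilon> over a length below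
    b.\<close>
  define K where "K = 2 * b / (d - c) + b * b"
  have K: "K > 0" unfolding K_def using ab cd by (intro add_pos_pos) auto
  have g_est: "\<bar>g m t - g n t\<bar> \<le> \<epsilon> * K"
    if h\<epsilon>: "\<And>t. t \<in> ?S \<Longrightarrow> \<bar>h m t - h n t\<bar> \<le> \<epsilon>"
      and f\<epsilon>: "\<bar>f m c - f n c\<bar> \<le> \<epsilon>" "\<bar>f m d - f n d\<bar> \<le> \<epsilon>" and t: "t \<in> ?S" and "\<epsilon> > 0"
    for m n t \<epsilon>
  proof -
    have "\<exists>z>c. z < d \<and> (f m d - f n d) - (f m c - f n c) = (d - c) * (f' m z - f' n z)"
      using cd by (intro MVT2) (auto intro!: DERIV_diff df)
    then obtain z where z: "c < z" "z < d"
      "(f m d - f n d) - (f m c - f n c) = (d - c) * (f' m z - f' n z)" by blast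
    have zS: "z \<in> ?S" using z cd by auto
    have "(d - c) * \<bar>f' m z - f' n z\<bar> = \<bar>(f m d - f n d) - (f m c - f n c)\<bar>"
      unfolding z(3) using cd by (simp add: abs_mult)
    also have "\<dots> \<le> 2 * \<epsilon>" using f\<epsilon> by linarith
    finally have "\<bar>f' m z - f' n z\<bar> \<le> 2 * \<epsilon> / (d - c)"
      using cd by (simp add: field_simps)
    then have "\<bar>g m z - g n z\<bar> \<le> b * (2 * \<epsilon> / (d - c))"
      unfolding g_def right_diff_distrib[symmetric] abs_mult
      using zS ab by (intro mult_mono) auto
    moreover have "norm ((g m t - g n t) - (g m z - g n z)) \<le> (b * \<epsilon>) * norm (t - z)"
    proof (rule field_differentiable_bound[of ?S "\<lambda>t. g m t - g n t" "\<lambda>t. t * h m t - t * h n t"])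
      show "((\<lambda>t. g m t - g n t) has_real_derivative y * h m y - y * h n y) (at y within ?S)"
        if "y \<in> ?S" for y
        by (intro DERIV_diff has_field_derivative_at_within[OF dg] that)
      show "norm (y * h m y - y * h n y) \<le> b * \<epsilon>" if "y \<in> ?S" for y
        unfolding right_diff_distrib[symmetric] norm_mult
        using that ab h\<epsilon> by (intro mult_mono) auto
    qed (use zS t in auto)
    moreover have "(b * \<epsilon>) * norm (t - z) \<le> (b * \<epsilon>) * b"
      using t zS ab \<open>\<epsilon> > 0\<close> by (intro mult_left_mono) auto
    ultimately show ?thesis
      unfolding K_def by (simp add: algebra_simps)
  qed
  have f'_cauchy: "uniformly_Cauchy_on ?S f'"
  proof (rule uniformly_Cauchy_onI)
    fix e :: real assume e: "e > 0"
    \<comment> \<open>The factor \<open>a\<close> compensates the division by t > a, and the 2 makes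
      the final inequality strict.\<close>
    define \<epsilon> where "\<epsilon> = e * a / (2 * K)"
    have \<epsilon>: "\<epsilon> > 0" using e ab K by (simp add: \<epsilon>_def)
    have "uniformly_convergent_on ?S h"
      using h by (auto simp: uniformly_convergent_on_def)
    then have "uniformly_Cauchy_on ?S h" by (rule uniformly_convergent_Cauchy)
    then obtain N1 where N1: "\<And>t m n. t \<in> ?S \<Longrightarrow> m \<ge> N1 \<Longrightarrow> n \<ge> N1 \<Longrightarrow> dist (h m t) (h n t) < \<epsilon>"
      using \<epsilon> unfolding uniformly_Cauchy_on_def by meson
    obtain N2 where N2: "\<And>m n. m \<ge> N2 \<Longrightarrow> n \<ge> N2 \<Longrightarrow> dist (f m c) (f n c) < \<epsilon>"
      using metric_CauchyD[OF LIMSEQ_imp_Cauchy[OF f[OF cd(1)]] \<epsilon>] by blast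
    obtain N3 where N3: "\<And>m n. m \<ge> N3 \<Longrightarrow> n \<ge> N3 \<Longrightarrow> dist (f m d) (f n d) < \<epsilon>"
      using metric_CauchyD[OF LIMSEQ_imp_Cauchy[OF f[OF cd(2)]] \<epsilon>] by blast
    show "\<exists>M. \<forall>t\<in>?S. \<forall>m\<ge>M. \<forall>n\<ge>M. dist (f' m t) (f' n t) < e"
    proof (intro exI[of _ "max N1 (max N2 N3)"] ballI allI impI)
      fix t m n assume t: "t \<in> ?S" and mn: "max N1 (max N2 N3) \<le> m" "max N1 (max N2 N3) \<le> n"
      have "\<bar>g m t - g n t\<bar> \<le> \<epsilon> * K"
        using N1 N2[of m n] N3[of m n] mn t \<epsilon> by (intro g_est) (auto simp: dist_real_def less_imp_le)
      then have "t * \<bar>f' m t - f' n t\<bar> \<le> e * a / 2"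
        unfolding g_def right_diff_distrib[symmetric] abs_mult using t ab K by (simp add: \<epsilon>_def)
      then have "\<bar>f' m t - f' n t\<bar> \<le> (e * a / 2) / t" using t ab by (simp add: field_simps)
      also have "\<dots> \<le> (e * a / 2) / a" using t ab e by (intro divide_left_mono) auto
      also have "\<dots> < e" using ab e by simp
      finally show "dist (f' m t) (f' n t) < e" by (simp add: dist_real_def)
    qed
  qed
  obtain F' where F': "uniform_limit ?S f' F' sequentially"
    using Cauchy_uniformly_convergent[OF f'_cauchy] by (auto simp: uniformly_convergent_on_def)
  have "uniform_limit ?S (\<lambda>n t. h n t - f' n t / t) (\<lambda>t. H t - F' t / t) sequentially"
  proof (intro uniform_limit_minus h)
    have "uniform_limit ?S (\<lambda>n t. f' n t * (1 / t)) (\<lambda>t. F' t * (1 / t)) sequentially"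
    proof (rule uniform_limitI)
      fix e :: real assume e: "e > 0"
      then have "e * a > 0" using ab by simp
      then have "\<forall>\<^sub>F n in sequentially. \<forall>t\<in>?S. dist (f' n t) (F' t) < e * a"
        using F' unfolding uniform_limit_iff by blast
      then show "\<forall>\<^sub>F n in sequentially. \<forall>t\<in>?S. dist (f' n t * (1 / t)) (F' t * (1 / t)) < e"
      proof eventually_elim
        case (elim n)
        show ?case
        proof
          fix t assume t: "t \<in> ?S"
          then have "\<bar>f' n t - F' t\<bar> < e * a" using elim by (auto simp: dist_real_def)
          also have "\<dots> \<le> e * t" using t e by (intro mult_left_mono) auto
          finally have "\<bar>f' n t - F' t\<bar> / t < e" using t ab by (simp add: divide_less_eq)
          moreover have "\<bar>f' n t / t - F' t / t\<bar> = \<bar>f' n t - F' t\<bar> / t"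
            using t ab by (simp add: diff_divide_distrib[symmetric])
          ultimately show "dist (f' n t * (1 / t)) (F' t * (1 / t)) < e"
            by (simp add: dist_real_def)
        qed
      qed
    qed
    then show "uniform_limit ?S (\<lambda>n t. f' n t / t) (\<lambda>t. F' t / t) sequentially" by simp
  qed
  then have "(F' has_real_derivative H t - F' t / t) (at t)" if "t \<in> ?S" for t
    by (intro has_real_derivative_uniform_limit[of ?S f', OF _ _ df' _ _ that] tendsto_uniform_limitI[OF F']) auto
  moreover have "(F has_real_derivative F' t) (at t)" if "t \<in> ?S" for t
    by (intro has_real_derivative_uniform_limit[of ?S f, OF _ _ df F' f that]) auto
  ultimately show ?thesis by blast
qed

section \<open>Fredholm series\<close>

(* HOL-Analysis declares this notation for two different constants; Infinite_Sum's is meant below. *)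
no_notation Infinite_Set_Sum.abs_summable_on (infix "abs'_summable'_on" 50)

text \<open>A finite set of tuples lies in the box of its coordinate projections, and over a box the
  sum of products is a product of sums.\<close>

lemma abs_summable_on_prod_PiE:
  fixes f :: "'a \<Rightarrow> 'b \<Rightarrow> real"
  assumes A: "finite A" and f: "\<And>i. i \<in> A \<Longrightarrow> f i abs_summable_on B i"
  shows "(\<lambda>g. \<Prod>i\<in>A. f i (g i)) abs_summable_on PiE A B"
  unfolding abs_summable_iff_bdd_above
proof (rule bdd_aboveI2)
  fix F assume "F \<in> {F. F \<subseteq> PiE A B \<and> finite F}"
  then have F: "F \<subseteq> PiE A B" "finite F" by auto
  define G where "G i = (\<lambda>g. g i) ` F" for i
  have G: "finite (G i)" for i using F by (simp add: G_def)
  have "(\<Sum>g\<in>F. norm (\<Prod>i\<in>A. f i (g i))) \<le> (\<Sum>g\<in>PiE A G. norm (\<Prod>i\<in>A. f i (g i)))"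
  proof (rule sum_mono2)
    show "finite (PiE A G)" using A G by (simp add: finite_PiE)
    show "F \<subseteq> PiE A G" using F(1) unfolding G_def PiE_def Pi_def by blast
  qed auto
  also have "\<dots> = (\<Sum>g\<in>PiE A G. \<Prod>i\<in>A. \<bar>f i (g i)\<bar>)"
    by (simp add: abs_prod)
  also have "\<dots> = (\<Prod>i\<in>A. \<Sum>y\<in>G i. \<bar>f i y\<bar>)"
    using A G by (intro prod_sum_PiE[symmetric]) auto
  also have "\<dots> \<le> (\<Prod>i\<in>A. \<Sum>\<^sub>\<infinity>y\<in>B i. \<bar>f i y\<bar>)"
  proof (rule prod_mono, intro conjI)
    fix i assume i: "i \<in> A"
    show "(\<Sum>y\<in>G i. \<bar>f i y\<bar>) \<le> (\<Sum>\<^sub>\<infinity>y\<in>B i. \<bar>f i y\<bar>)"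
      using f[OF i] G[of i] F(1) i by (intro finite_sum_le_infsum) (auto simp: G_def)
  qed (simp add: sum_nonneg)
  finally show "(\<Sum>g\<in>F. norm (\<Prod>i\<in>A. f i (g i))) \<le> (\<Prod>i\<in>A. \<Sum>\<^sub>\<infinity>y\<in>B i. \<bar>f i y\<bar>)" .
qed

lemma infsum_finite_sum:
  fixes f :: "'a \<Rightarrow> 'b \<Rightarrow> real"
  assumes "finite P" "\<And>p. p \<in> P \<Longrightarrow> f p summable_on X"
  shows "(\<Sum>\<^sub>\<infinity>x\<in>X. \<Sum>p\<in>P. f p x) = (\<Sum>p\<in>P. infsum (f p) X)"
    and "(\<lambda>x. \<Sum>p\<in>P. f p x) summable_on X"
proof -
  have "((\<lambda>x. \<Sum>p\<in>P. f p x) has_sum (\<Sum>p\<in>P. infsum (f p) X)) X"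
    using assms
  proof (induction P)
    case (insert p P)
    then show ?case by (simp add: has_sum_add)
  qed simp
  then show "(\<Sum>\<^sub>\<infinity>x\<in>X. \<Sum>p\<in>P. f p x) = (\<Sum>p\<in>P. infsum (f p) X)"
    and "(\<lambda>x. \<Sum>p\<in>P. f p x) summable_on X"
    by (auto simp: infsumI summable_on_def)
qed

lemma has_sum_diff_real:
  fixes f g :: "'a \<Rightarrow> real"
  assumes "(f has_sum a) X" "(g has_sum b) X"
  shows "((\<lambda>x. f x - g x) has_sum (a - b)) X"
  using has_sum_add[OF assms(1), of "\<lambda>x. - g x" "- b"] assms(2) by (simp add: has_sum_uminus)

text \<open>The identity det(1 - V^T sigma V) = det(1 - sigma V V^T), degree by degree. For each
  permutation both sides sum the same array \<open>H p\<close> over pairs of tuples, in the two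
  possible orders. Summing over \<open>x\<close> first moves the permutation to \<open>l\<close> as
  its inverse, which has the same sign. For the exchange, one of the two factors \<open>v\<close> at
  each index is bounded by \<open>C\<close> while the other carries the summability.\<close>

lemma infsum_kdet_duality:
  fixes v :: "real \<Rightarrow> real \<Rightarrow> real" and \<sigma> :: "real \<Rightarrow> real" and X Y :: "real set"
  assumes \<sigma>: "\<And>l. l \<in> Y \<Longrightarrow> 0 \<le> \<sigma> l"
    and C: "0 \<le> C" "\<And>l x. l \<in> Y \<Longrightarrow> x \<in> X \<Longrightarrow> \<bar>v l x\<bar> \<le> C"
    and S1: "\<And>l. l \<in> Y \<Longrightarrow> (\<lambda>x. \<sigma> l * \<bar>v l x\<bar>) summable_on X"
    and S2: "(\<lambda>l. \<Sum>\<^sub>\<infinity>x\<in>X. \<sigma> l * \<bar>v l x\<bar>) summable_on Y"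
  defines "K \<equiv> \<lambda>a b. \<Sum>\<^sub>\<infinity>l\<in>Y. \<sigma> l * v l a * v l b"
    and "B \<equiv> \<lambda>l l'. \<Sum>\<^sub>\<infinity>x\<in>X. v l x * v l' x"
  shows "(\<Sum>\<^sub>\<infinity>x\<in>PiE {..<n} (\<lambda>_. X). kdet K n x)
    = (\<Sum>\<^sub>\<infinity>l\<in>PiE {..<n} (\<lambda>_. Y). (\<Prod>i<n. \<sigma> (l i)) * kdet B n l)"
proof -
  let ?PX = "PiE {..<n} (\<lambda>_. X)" and ?PY = "PiE {..<n} (\<lambda>_. Y)"
  let ?P = "{p. p permutes {..<n}}"
  have finP: "finite ?P" by (simp add: finite_permutations)
  define F where "F l x = C * (\<sigma> l * \<bar>v l x\<bar>)" for l x
  have F0: "F l x \<ge> 0" if "l \<in> Y" for l x using C \<sigma>[OF that] by (simp add: F_def)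
  define W where "W l = (\<Sum>\<^sub>\<infinity>x\<in>X. F l x)" for l
  have F1: "F l abs_summable_on X" if "l \<in> Y" for l
    using summable_on_cmult_right[OF S1[OF that], of C] F0[OF that] by (simp add: F_def)
  have W0: "W l \<ge> 0" if "l \<in> Y" for l unfolding W_def using F0[OF that] by (simp add: infsum_nonneg)
  have W1: "W abs_summable_on Y"
  proof -
    have "W = (\<lambda>l. C * (\<Sum>\<^sub>\<infinity>x\<in>X. \<sigma> l * \<bar>v l x\<bar>))"
      unfolding W_def F_def by (rule ext, rule infsum_cmult_right')
    then have "W summable_on Y"
      using summable_on_cmult_right[OF S2, of C] by simp
    then show ?thesis by (rule summable_on_cong[THEN iffD1, rotated]) (use W0 in auto)
  qed
  define H where "H p l x = (\<Prod>i<n. \<sigma> (l i) * v (l i) (x i) * v (l i) (x (p i)))" for p :: "nat \<Rightarrow> nat" and l x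
  have Fsum: "(\<lambda>(l, x). \<Prod>i<n. F (l i) (x i)) abs_summable_on ?PY \<times> ?PX"
  proof -
    have 1: "(\<lambda>x. \<Prod>i<n. F (l i) (x i)) abs_summable_on ?PX" if "l \<in> ?PY" for l
      using that by (intro abs_summable_on_prod_PiE F1) auto
    have "(\<Sum>\<^sub>\<infinity>x\<in>?PX. norm (\<Prod>i<n. F (l i) (x i))) = (\<Prod>i<n. W (l i))" if l: "l \<in> ?PY" for l
    proof -
      have "(\<Sum>\<^sub>\<infinity>x\<in>?PX. norm (\<Prod>i<n. F (l i) (x i))) = (\<Sum>\<^sub>\<infinity>x\<in>?PX. \<Prod>i<n. F (l i) (x i))"
        using l F0 by (intro infsum_cong) (auto simp: PiE_iff intro!: abs_of_nonneg prod_nonneg)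
      also have "\<dots> = (\<Prod>i<n. W (l i))"
        unfolding W_def using l by (intro infsum_prod_PiE_abs F1) auto
      finally show ?thesis .
    qed
    moreover have "(\<lambda>l. \<Prod>i<n. W (l i)) abs_summable_on ?PY"
      by (intro abs_summable_on_prod_PiE W1) auto
    ultimately have 2: "(\<lambda>l. \<Sum>\<^sub>\<infinity>x\<in>?PX. norm (\<Prod>i<n. F (l i) (x i))) abs_summable_on ?PY"
      by (metis (no_types, lifting) summable_on_cong)
    show ?thesis
      unfolding Infinite_Sum.abs_summable_on_Sigma_iff using 1 2 by simp
  qed
  have Hsum: "(\<lambda>(l, x). H p l x) abs_summable_on ?PY \<times> ?PX" if "p \<in> ?P" for p
  proof (rule Infinite_Sum.abs_summable_on_comparison_test[OF Fsum], clarify)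
    fix l x assume l: "l \<in> ?PY" and x: "x \<in> ?PX"
    have "\<bar>H p l x\<bar> = (\<Prod>i<n. \<bar>\<sigma> (l i) * v (l i) (x i) * v (l i) (x (p i))\<bar>)"
      by (simp add: H_def abs_prod)
    also have "\<dots> \<le> (\<Prod>i<n. F (l i) (x i))"
    proof (rule prod_mono, intro conjI)
      fix i assume i: "i \<in> {..<n}"
      then have "p i \<in> {..<n}" using that permutes_in_image[of p "{..<n}" i] by simp
      then have "\<bar>v (l i) (x (p i))\<bar> \<le> C" using l x i by (intro C) auto
      moreover have "\<sigma> (l i) \<ge> 0" using l i by (intro \<sigma>) auto
      ultimately have "\<sigma> (l i) * \<bar>v (l i) (x i)\<bar> * \<bar>v (l i) (x (p i))\<bar> \<le> \<sigma> (l i) * \<bar>v (l i) (x i)\<bar> * C"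
        by (intro mult_left_mono) auto
      with \<open>\<sigma> (l i) \<ge> 0\<close> show "\<bar>\<sigma> (l i) * v (l i) (x i) * v (l i) (x (p i))\<bar> \<le> F (l i) (x i)"
        by (simp add: F_def abs_mult mult_ac)
    qed simp
    finally show "norm (H p l x) \<le> norm (\<Prod>i<n. F (l i) (x i))" by simp
  qed
  have swap: "(\<Sum>\<^sub>\<infinity>x\<in>?PX. \<Sum>\<^sub>\<infinity>l\<in>?PY. H p l x) = (\<Sum>\<^sub>\<infinity>l\<in>?PY. \<Sum>\<^sub>\<infinity>x\<in>?PX. H p l x)"
    "(\<lambda>x. \<Sum>\<^sub>\<infinity>l\<in>?PY. H p l x) summable_on ?PX"
    "(\<lambda>l. \<Sum>\<^sub>\<infinity>x\<in>?PX. H p l x) summable_on ?PY" if "p \<in> ?P" for p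
  proof -
    have s: "(\<lambda>(l, x). H p l x) summable_on ?PY \<times> ?PX"
      using abs_summable_summable[OF Hsum[OF that]] .
    then have s': "(\<lambda>(x, l). H p l x) summable_on ?PX \<times> ?PY"
      using summable_on_swap[of "\<lambda>(l, x). H p l x"] by simp
    show "(\<Sum>\<^sub>\<infinity>x\<in>?PX. \<Sum>\<^sub>\<infinity>l\<in>?PY. H p l x) = (\<Sum>\<^sub>\<infinity>l\<in>?PY. \<Sum>\<^sub>\<infinity>x\<in>?PX. H p l x)"
      by (rule infsum_swap_banach[OF s'])
    show "(\<lambda>x. \<Sum>\<^sub>\<infinity>l\<in>?PY. H p l x) summable_on ?PX"
      using summable_on_Sigma_banach[OF s'] by simp
    show "(\<lambda>l. \<Sum>\<^sub>\<infinity>x\<in>?PX. H p l x) summable_on ?PY"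
      using summable_on_Sigma_banach[OF s] by simp
  qed
  have Ksum: "(\<lambda>l. \<sigma> l * v l a * v l b) abs_summable_on Y" if "a \<in> X" "b \<in> X" for a b
  proof (rule Infinite_Sum.abs_summable_on_comparison_test[OF W1])
    fix l assume l: "l \<in> Y"
    have "\<bar>v l b\<bar> * (\<sigma> l * \<bar>v l a\<bar>) \<le> C * (\<sigma> l * \<bar>v l a\<bar>)"
      using C l that \<sigma> by (intro mult_right_mono) auto
    then have "norm (\<sigma> l * v l a * v l b) \<le> F l a"
      using \<sigma>[OF l] by (simp add: F_def abs_mult mult_ac)
    also have "F l a = (\<Sum>x\<in>{a}. F l x)" by simp
    also have "\<dots> \<le> W l"
      unfolding W_def using F1[OF l] F0[OF l] that by (intro finite_sum_le_infsum) auto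
    also have "\<dots> \<le> norm (W l)" by simp
    finally show "norm (\<sigma> l * v l a * v l b) \<le> norm (W l)" .
  qed
  have Kprod: "(\<Prod>i<n. K (x i) (x (p i))) = (\<Sum>\<^sub>\<infinity>l\<in>?PY. H p l x)" if "p \<in> ?P" "x \<in> ?PX" for p x
  proof -
    have "x (p i) \<in> X" if "i < n" for i
      using that \<open>x \<in> ?PX\<close> permutes_in_image[of p "{..<n}" i] \<open>p \<in> ?P\<close> by auto
    then show ?thesis
      unfolding K_def H_def using that by (intro infsum_prod_PiE_abs[symmetric] Ksum) auto
  qed
  have Bprod: "(\<Sum>\<^sub>\<infinity>x\<in>?PX. H p l x) = (\<Prod>i<n. \<sigma> (l i)) * (\<Prod>i<n. B (l i) (l (inv_into UNIV p i)))"
    if "p \<in> ?P" "l \<in> ?PY" for p l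
  proof -
    have p: "p permutes {..<n}" using that by simp
    have Hp: "H p l x = (\<Prod>i<n. \<sigma> (l i) * (v (l i) (x i) * v (l (inv_into UNIV p i)) (x i)))" for x
    proof -
      have "(\<Prod>i<n. v (l i) (x (p i))) = (\<Prod>i<n. v (l (inv_into UNIV p (p i))) (x (p i)))"
        using permutes_inverses[OF p] by simp
      also have "\<dots> = (\<Prod>i<n. v (l (inv_into UNIV p i)) (x i))"
        using prod.permute[OF p, of "\<lambda>i. v (l (inv_into UNIV p i)) (x i)"] by (simp add: o_def)
      finally show ?thesis by (simp add: H_def prod.distrib)
    qed
    have "(\<Sum>\<^sub>\<infinity>x\<in>?PX. H p l x)
        = (\<Prod>i<n. \<Sum>\<^sub>\<infinity>x\<in>X. \<sigma> (l i) * (v (l i) x * v (l (inv_into UNIV p i)) x))"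
      unfolding Hp
    proof (rule infsum_prod_PiE_abs)
      fix i assume i: "i \<in> {..<n}"
      then have li: "l i \<in> Y" using that by auto
      have "inv_into UNIV p i \<in> {..<n}" using permutes_in_image[OF permutes_inv[OF p]] i by simp
      then have lj: "l (inv_into UNIV p i) \<in> Y" using that by auto
      show "(\<lambda>x. \<sigma> (l i) * (v (l i) x * v (l (inv_into UNIV p i)) x)) abs_summable_on X"
      proof (rule Infinite_Sum.abs_summable_on_comparison_test[OF F1[OF li]])
        fix x assume x: "x \<in> X"
        have "\<bar>v (l (inv_into UNIV p i)) x\<bar> * (\<sigma> (l i) * \<bar>v (l i) x\<bar>) \<le> C * (\<sigma> (l i) * \<bar>v (l i) x\<bar>)"
          using C li lj x \<sigma> by (intro mult_right_mono) auto
        then show "norm (\<sigma> (l i) * (v (l i) x * v (l (inv_into UNIV p i)) x)) \<le> norm (F (l i) x)"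
          using F0[OF li, of x] \<sigma>[OF li] C(1) by (simp add: F_def abs_mult mult_ac)
      qed
    qed simp
    also have "\<dots> = (\<Prod>i<n. \<sigma> (l i) * B (l i) (l (inv_into UNIV p i)))"
      unfolding B_def infsum_cmult_right' ..
    finally show ?thesis by (simp add: prod.distrib)
  qed
  have "(\<Sum>\<^sub>\<infinity>x\<in>?PX. kdet K n x) = (\<Sum>\<^sub>\<infinity>x\<in>?PX. \<Sum>p\<in>?P. of_int (sign p) * (\<Sum>\<^sub>\<infinity>l\<in>?PY. H p l x))"
    unfolding kdet_def by (intro infsum_cong sum.cong refl) (simp add: Kprod)
  also have "\<dots> = (\<Sum>p\<in>?P. \<Sum>\<^sub>\<infinity>x\<in>?PX. of_int (sign p) * (\<Sum>\<^sub>\<infinity>l\<in>?PY. H p l x))"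
    by (intro infsum_finite_sum(1) finP summable_on_cmult_right swap)
  also have "\<dots> = (\<Sum>p\<in>?P. \<Sum>\<^sub>\<infinity>l\<in>?PY. of_int (sign p) * (\<Sum>\<^sub>\<infinity>x\<in>?PX. H p l x))"
    unfolding infsum_cmult_right' by (intro sum.cong refl) (simp add: swap(1))
  also have "\<dots> = (\<Sum>\<^sub>\<infinity>l\<in>?PY. \<Sum>p\<in>?P. of_int (sign p) * (\<Sum>\<^sub>\<infinity>x\<in>?PX. H p l x))"
    by (intro infsum_finite_sum(1)[symmetric] finP summable_on_cmult_right swap)
  also have "\<dots> = (\<Sum>\<^sub>\<infinity>l\<in>?PY. (\<Prod>i<n. \<sigma> (l i)) * kdet B n l)"
  proof (rule infsum_cong)
    fix l assume l: "l \<in> ?PY"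
    have "(\<Sum>p\<in>?P. of_int (sign p) * (\<Sum>\<^sub>\<infinity>x\<in>?PX. H p l x))
        = (\<Sum>p\<in>?P. (\<Prod>i<n. \<sigma> (l i)) * (of_int (sign (inv_into UNIV p)) * (\<Prod>i<n. B (l i) (l (inv_into UNIV p i)))))"
    proof (intro sum.cong refl)
      fix p assume p: "p \<in> ?P"
      then have "sign (inv_into UNIV p) = sign p"
        by (intro sign_inverse permutes_imp_permutation[of "{..<n}"]) auto
      then show "of_int (sign p) * (\<Sum>\<^sub>\<infinity>x\<in>?PX. H p l x)
        = (\<Prod>i<n. \<sigma> (l i)) * (of_int (sign (inv_into UNIV p)) * (\<Prod>i<n. B (l i) (l (inv_into UNIV p i))))"
        by (simp add: Bprod[OF p l])
    qed
    also have "\<dots> = (\<Prod>i<n. \<sigma> (l i)) * kdet B n l"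
      unfolding kdet_def sum_distrib_left by (rule sum_permutations_inverse[symmetric])
    finally show "(\<Sum>p\<in>?P. of_int (sign p) * (\<Sum>\<^sub>\<infinity>x\<in>?PX. H p l x)) = (\<Prod>i<n. \<sigma> (l i)) * kdet B n l" .
  qed
  finally show ?thesis .
qed

section \<open>Bounds for minors and comparison of Fredholm series\<close>

lemma kdet_eq_det: "kdet A n x = Determinant.det (Matrix.mat n n (\<lambda>(i, j). A (x i) (x j)))"
  unfolding kdet_def
proof (subst det_def'[of _ n], simp, intro sum.cong)
  show "{p. p permutes {..<n}} = {p. p permutes {0..<n}}" by (simp add: lessThan_atLeast0)
  fix p assume "p \<in> {p. p permutes {0..<n}}"
  then have "p i < n" if "i < n" for i
    using permutes_in_image[of p "{0..<n}" i] that by simp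
  then show "of_int (sign p) * (\<Prod>i<n. A (x i) (x (p i)))
      = signof p * (\<Prod>i = 0..<n. Matrix.mat n n (\<lambda>(i, j). A (x i) (x j)) $$ (i, p i))"
    by (auto simp: lessThan_atLeast0 intro!: prod.cong)
qed

lemma kdet_not_inj: "\<not> inj_on x {..<n} \<Longrightarrow> kdet A n x = 0"
proof -
  assume "\<not> inj_on x {..<n}"
  then obtain i j where ij: "i < n" "j < n" "i \<noteq> j" "x i = x j" by (auto simp: inj_on_def)
  show ?thesis
    unfolding kdet_eq_det
    by (rule det_identical_rows[OF _ ij(3,1,2)]) (use ij in \<open>auto intro!: eq_vecI\<close>)
qed

text \<open>A crude substitute for Hadamard's inequality: on injective tuples the row sums of the minor
  are bounded by those of the whole kernel.\<close>

lemma abs_kdet_le: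
  assumes w: "\<And>y F. y \<in> Y \<Longrightarrow> finite F \<Longrightarrow> F \<subseteq> Y \<Longrightarrow> (\<Sum>z\<in>F. \<bar>A y z\<bar>) \<le> w y"
    and x: "x \<in> PiE {..<n} (\<lambda>_. Y)"
  shows "\<bar>kdet A n x\<bar> \<le> (\<Prod>i<n. w (x i))"
proof (cases "inj_on x {..<n}")
  case False
  have "w (x i) \<ge> 0" if "i < n" for i using w[of "x i" "{}"] that x by auto
  then show ?thesis using kdet_not_inj[OF False] by (auto intro!: prod_nonneg)
next
  case True
  let ?P = "{p. p permutes {..<n}}"
  have "\<bar>kdet A n x\<bar> \<le> (\<Sum>p\<in>?P. \<bar>of_int (sign p) * (\<Prod>i<n. A (x i) (x (p i)))\<bar>)"
    unfolding kdet_def by (rule sum_abs)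
  also have "\<dots> = (\<Sum>p\<in>?P. \<Prod>i<n. \<bar>A (x i) (x (p i))\<bar>)"
    by (intro sum.cong refl) (simp add: abs_mult abs_prod flip: of_int_abs)
  \<comment> \<open>A permutation is the identity outside {..<n}, whereas members of
    \<open>PiE\<close> are \<open>undefined\<close> there; hence the restriction.\<close>
  also have "\<dots> = (\<Sum>f\<in>(\<lambda>p. restrict p {..<n}) ` ?P. \<Prod>i<n. \<bar>A (x i) (x (f i))\<bar>)"
  proof (subst sum.reindex)
    show "inj_on (\<lambda>p. restrict p {..<n}) ?P"
    proof (rule inj_onI, rule ext)
      fix p q i assume "p \<in> ?P" "q \<in> ?P" and e: "restrict p {..<n} = restrict q {..<n}"
      have "restrict p {..<n} i = restrict q {..<n} i" by (simp only: e)
      then show "p i = q i"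
        using permutes_not_in[of p "{..<n}" i] permutes_not_in[of q "{..<n}" i] \<open>p \<in> ?P\<close> \<open>q \<in> ?P\<close>
        by (cases "i < n") simp_all
    qed
  qed simp
  \<comment> \<open>Admitting all maps of {..<n} into itself only adds nonnegative terms and lets
    the sum factor into row sums.\<close>
  also have "\<dots> \<le> (\<Sum>f\<in>PiE {..<n} (\<lambda>_. {..<n}). \<Prod>i<n. \<bar>A (x i) (x (f i))\<bar>)"
  proof (rule sum_mono2)
    show "(\<lambda>p. restrict p {..<n}) ` ?P \<subseteq> PiE {..<n} (\<lambda>_. {..<n})"
      using permutes_in_image by (fastforce simp: PiE_iff)
  qed (auto simp: finite_PiE prod_nonneg)
  also have "\<dots> = (\<Prod>i<n. \<Sum>j<n. \<bar>A (x i) (x j)\<bar>)"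
    by (rule prod_sum_PiE[symmetric]) auto
  also have "\<dots> \<le> (\<Prod>i<n. w (x i))"
  proof (rule prod_mono, intro conjI)
    fix i assume i: "i \<in> {..<n}"
    \<comment> \<open>Injectivity makes the columns distinct points, so the row sum is one over a
      finite set, as \<open>w\<close> requires.\<close>
    have "(\<Sum>j<n. \<bar>A (x i) (x j)\<bar>) = (\<Sum>y\<in>x ` {..<n}. \<bar>A (x i) y\<bar>)"
      by (simp add: sum.reindex[OF True])
    also have "\<dots> \<le> w (x i)" using x i by (intro w) auto
    finally show "(\<Sum>j<n. \<bar>A (x i) (x j)\<bar>) \<le> w (x i)" .
  qed (simp add: sum_nonneg)
  finally show ?thesis .
qed

text \<open>det(1 - sigma A) with sigma as a weight on the points instead of a part of the kernel,
  so that two weights can be compared on the same minors.\<close>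

definition fredholm_series :: "(real \<Rightarrow> real) \<Rightarrow> (real \<Rightarrow> real \<Rightarrow> real) \<Rightarrow> real set \<Rightarrow> real" where
  "fredholm_series \<sigma> A Y = (\<Sum>n. (-1) ^ n / fact n *
     (\<Sum>\<^sub>\<infinity>l\<in>PiE {..<n} (\<lambda>_. Y). (\<Prod>i<n. \<sigma> (l i)) * kdet A n l))"

text \<open>As \<open>\<sigma>'\<close> lies below \<open>\<sigma>\<close>, the two products of
  weights on a tuple differ by a nonnegative amount, and the minor is at most the product of the
  \<open>w\<close>. Summing over tuples gives W^n - W'^n, and division by n! the difference of
  exponentials. The bound sees \<open>A\<close> only through \<open>w\<close>, which later makes it
  uniform in \<open>t\<close>.\<close>

lemma fredholm_series_diff_le:
  fixes \<sigma> \<sigma>' w :: "real \<Rightarrow> real"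
  assumes w: "\<And>y F. y \<in> Y \<Longrightarrow> finite F \<Longrightarrow> F \<subseteq> Y \<Longrightarrow> (\<Sum>z\<in>F. \<bar>A y z\<bar>) \<le> w y"
    and \<sigma>: "\<And>y. y \<in> Y \<Longrightarrow> 0 \<le> \<sigma>' y \<and> \<sigma>' y \<le> \<sigma> y"
    and sum: "(\<lambda>y. \<sigma> y * w y) summable_on Y"
  shows "\<bar>fredholm_series \<sigma> A Y - fredholm_series \<sigma>' A Y\<bar>
    \<le> exp (\<Sum>\<^sub>\<infinity>y\<in>Y. \<sigma> y * w y) - exp (\<Sum>\<^sub>\<infinity>y\<in>Y. \<sigma>' y * w y)"
proof -
  let ?PY = "\<lambda>n. PiE {..<n} (\<lambda>_::nat. Y)"
  have w0: "w y \<ge> 0" if "y \<in> Y" for y using w[OF that, of "{}"] by simp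
  have sum': "(\<lambda>y. \<sigma>' y * w y) summable_on Y"
    by (rule summable_on_comparison_test[OF sum]) (use \<sigma> w0 in \<open>auto intro!: mult_right_mono\<close>)
  define W W' where "W = (\<Sum>\<^sub>\<infinity>y\<in>Y. \<sigma> y * w y)" and "W' = (\<Sum>\<^sub>\<infinity>y\<in>Y. \<sigma>' y * w y)"
  have key: "(\<lambda>l. \<Prod>i<n. \<tau> (l i) * w (l i)) summable_on ?PY n"
    "(\<Sum>\<^sub>\<infinity>l\<in>?PY n. \<Prod>i<n. \<tau> (l i) * w (l i)) = (\<Sum>\<^sub>\<infinity>y\<in>Y. \<tau> y * w y) ^ n"
    "(\<lambda>l. (\<Prod>i<n. \<tau> (l i)) * kdet A n l) abs_summable_on ?PY n"
    if \<tau>: "\<And>y. y \<in> Y \<Longrightarrow> 0 \<le> \<tau> y" "(\<lambda>y. \<tau> y * w y) summable_on Y" for \<tau> n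
  proof -
    have a: "(\<lambda>y. \<tau> y * w y) abs_summable_on Y"
      by (rule summable_on_cong[THEN iffD1, OF _ \<tau>(2)]) (use \<tau>(1) w0 in auto)
    have b: "(\<lambda>l. \<Prod>i<n. \<tau> (l i) * w (l i)) abs_summable_on ?PY n"
      by (intro abs_summable_on_prod_PiE a) auto
    then show "(\<lambda>l. \<Prod>i<n. \<tau> (l i) * w (l i)) summable_on ?PY n"
      by (rule abs_summable_summable)
    show "(\<Sum>\<^sub>\<infinity>l\<in>?PY n. \<Prod>i<n. \<tau> (l i) * w (l i)) = (\<Sum>\<^sub>\<infinity>y\<in>Y. \<tau> y * w y) ^ n"
      by (subst infsum_prod_PiE_abs) (use a in auto)
    show "(\<lambda>l. (\<Prod>i<n. \<tau> (l i)) * kdet A n l) abs_summable_on ?PY n"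
    proof (rule Infinite_Sum.abs_summable_on_comparison_test[OF b])
      fix l assume l: "l \<in> ?PY n"
      have p: "(\<Prod>i<n. \<tau> (l i)) \<ge> 0" using l \<tau> by (intro prod_nonneg) auto
      have "norm ((\<Prod>i<n. \<tau> (l i)) * kdet A n l) = (\<Prod>i<n. \<tau> (l i)) * \<bar>kdet A n l\<bar>"
        using p by (simp add: abs_mult)
      also have "\<dots> \<le> (\<Prod>i<n. \<tau> (l i)) * (\<Prod>i<n. w (l i))"
        by (intro mult_left_mono abs_kdet_le[OF w l] p)
      finally show "norm ((\<Prod>i<n. \<tau> (l i)) * kdet A n l) \<le> norm (\<Prod>i<n. \<tau> (l i) * w (l i))"
        by (simp add: prod.distrib)
    qed
  qed
  have \<sigma>0: "0 \<le> \<sigma> y" "0 \<le> \<sigma>' y" if "y \<in> Y" for y using \<sigma>[OF that] by auto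
  define a where "a \<tau> n = (\<Sum>\<^sub>\<infinity>l\<in>?PY n. (\<Prod>i<n. \<tau> (l i)) * kdet A n l)" for \<tau> :: "real \<Rightarrow> real" and n
  have diff: "\<bar>a \<sigma> n - a \<sigma>' n\<bar> \<le> W ^ n - W' ^ n" for n
  proof -
    let ?d = "\<lambda>l. (\<Prod>i<n. \<sigma> (l i)) * kdet A n l - (\<Prod>i<n. \<sigma>' (l i)) * kdet A n l"
    let ?e = "\<lambda>l. (\<Prod>i<n. \<sigma> (l i) * w (l i)) - (\<Prod>i<n. \<sigma>' (l i) * w (l i))"
    note s = abs_summable_summable[OF key(3)[OF \<sigma>0(1) sum]] abs_summable_summable[OF key(3)[OF \<sigma>0(2) sum']]
    have t: "((\<lambda>l. \<Prod>i<n. \<sigma> (l i) * w (l i)) has_sum W ^ n) (?PY n)"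
      "((\<lambda>l. \<Prod>i<n. \<sigma>' (l i) * w (l i)) has_sum W' ^ n) (?PY n)"
      using has_sum_infsum[OF key(1)[OF \<sigma>0(1) sum, of n]] has_sum_infsum[OF key(1)[OF \<sigma>0(2) sum', of n]]
      by (simp_all only: key(2)[OF \<sigma>0(1) sum] key(2)[OF \<sigma>0(2) sum'] W_def W'_def)
    have "(?d has_sum (a \<sigma> n - a \<sigma>' n)) (?PY n)"
      unfolding a_def by (intro has_sum_diff_real has_sum_infsum s)
    moreover have "(?e has_sum (W ^ n - W' ^ n)) (?PY n)"
      by (intro has_sum_diff_real t)
    moreover have "norm (?d l) \<le> ?e l" if l: "l \<in> ?PY n" for l
    proof -
      have p: "(\<Prod>i<n. \<sigma>' (l i)) \<le> (\<Prod>i<n. \<sigma> (l i))" using l \<sigma> by (intro prod_mono) auto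
      have "norm (?d l) = ((\<Prod>i<n. \<sigma> (l i)) - (\<Prod>i<n. \<sigma>' (l i))) * \<bar>kdet A n l\<bar>"
        using p by (simp add: left_diff_distrib[symmetric] abs_mult)
      also have "\<dots> \<le> ((\<Prod>i<n. \<sigma> (l i)) - (\<Prod>i<n. \<sigma>' (l i))) * (\<Prod>i<n. w (l i))"
        using p by (intro mult_left_mono abs_kdet_le[OF w l]) auto
      finally show ?thesis by (simp add: prod.distrib left_diff_distrib)
    qed
    ultimately have "norm (a \<sigma> n - a \<sigma>' n) \<le> W ^ n - W' ^ n" by (rule norm_infsum_le)
    then show ?thesis by simp
  qed
  have bound: "\<bar>a \<tau> n\<bar> \<le> (\<Sum>\<^sub>\<infinity>y\<in>Y. \<tau> y * w y) ^ n"
    if \<tau>: "\<And>y. y \<in> Y \<Longrightarrow> 0 \<le> \<tau> y" "(\<lambda>y. \<tau> y * w y) summable_on Y" for \<tau> n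
  proof -
    have "norm ((\<Prod>i<n. \<tau> (l i)) * kdet A n l) \<le> (\<Prod>i<n. \<tau> (l i) * w (l i))" if l: "l \<in> ?PY n" for l
    proof -
      have p: "(\<Prod>i<n. \<tau> (l i)) \<ge> 0" using l \<tau> by (intro prod_nonneg) auto
      then show ?thesis
        using mult_left_mono[OF abs_kdet_le[OF w l] p] by (simp add: abs_mult prod.distrib)
    qed
    with has_sum_infsum[OF abs_summable_summable[OF key(3)[OF \<tau>]]] has_sum_infsum[OF key(1)[OF \<tau>]]
    have "norm (a \<tau> n) \<le> (\<Sum>\<^sub>\<infinity>l\<in>?PY n. \<Prod>i<n. \<tau> (l i) * w (l i))"
      unfolding a_def by (rule norm_infsum_le)
    then show ?thesis by (simp add: key(2)[OF \<tau>])
  qed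
  have exps: "(\<lambda>n. x ^ n / fact n) sums exp x" for x :: real
    using exp_converges[of x] by (simp add: field_simps)
  have sm: "summable (\<lambda>n. (-1) ^ n / fact n * a \<tau> n)"
    if \<tau>: "\<And>y. y \<in> Y \<Longrightarrow> 0 \<le> \<tau> y" "(\<lambda>y. \<tau> y * w y) summable_on Y" for \<tau>
  proof (rule summable_comparison_test'[OF sums_summable[OF exps], of 0])
    fix n
    show "norm ((-1) ^ n / fact n * a \<tau> n) \<le> (\<Sum>\<^sub>\<infinity>y\<in>Y. \<tau> y * w y) ^ n / fact n"
      using bound[OF \<tau>, of n] by (simp add: abs_mult power_abs divide_right_mono)
  qed
  have "fredholm_series \<sigma> A Y - fredholm_series \<sigma>' A Y
      = (\<Sum>n. (-1) ^ n / fact n * a \<sigma> n - (-1) ^ n / fact n * a \<sigma>' n)"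
    unfolding fredholm_series_def a_def[symmetric] by (intro suminf_diff sm \<sigma>0 sum sum')
  also have "\<bar>\<dots>\<bar> \<le> (\<Sum>n. W ^ n / fact n - W' ^ n / fact n)"
  proof (rule norm_suminf_le[where 'a = real, unfolded real_norm_def])
    fix n
    have "\<bar>(-1) ^ n / fact n * a \<sigma> n - (-1) ^ n / fact n * a \<sigma>' n\<bar> = \<bar>a \<sigma> n - a \<sigma>' n\<bar> / fact n"
      by (simp only: right_diff_distrib[symmetric] abs_mult abs_divide power_abs) simp
    also have "\<dots> \<le> (W ^ n - W' ^ n) / fact n" by (intro divide_right_mono diff) simp
    finally show "\<bar>(-1) ^ n / fact n * a \<sigma> n - (-1) ^ n / fact n * a \<sigma>' n\<bar>
      \<le> W ^ n / fact n - W' ^ n / fact n" by (simp add: diff_divide_distrib)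
  qed (intro summable_diff sums_summable[OF exps])
  also have "\<dots> = exp W - exp W'"
    by (intro sums_unique[symmetric] sums_diff exps)
  finally show ?thesis by (simp add: W_def W'_def)
qed

section \<open>Finite support: from the Fredholm series to a determinant\<close>

definition pminor :: "('a \<Rightarrow> 'a \<Rightarrow> real) \<Rightarrow> 'a set \<Rightarrow> real" where
  "pminor A S = (\<Sum>p | p permutes S. of_int (sign p) * (\<Prod>i\<in>S. A i (p i)))"

text \<open>Conjugation by \<open>f\<close> carries the permutations of \<open>T\<close> to those of
  its image and preserves signs. This lets a minor be indexed by a set of points rather than by an
  enumeration.\<close>

lemma pminor_image:
  assumes f: "inj_on f T" and T: "finite T"
  shows "pminor A (f ` T) = pminor (\<lambda>i j. A (f i) (f j)) T"
proof -
  have bij: "bij_betw f T (f ` T)" using f by (simp add: bij_betw_def)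
  have "bij_betw (map_permutation T f) {p. p permutes T} {p. p permutes f ` T}"
    using bij_betw_permutations[OF bij]
    by (simp add: map_permutation_def[abs_def] restrict_id_def o_def)
  then have "pminor A (f ` T) = (\<Sum>p | p permutes T. of_int (sign (map_permutation T f p)) *
      (\<Prod>i\<in>f ` T. A i (map_permutation T f p i)))"
    unfolding pminor_def by (rule sum.reindex_bij_betw[symmetric])
  also have "\<dots> = pminor (\<lambda>i j. A (f i) (f j)) T"
    unfolding pminor_def
  proof (intro sum.cong refl)
    fix p assume "p \<in> {p. p permutes T}"
    then have p: "p permutes T" by simp
    have "(\<Prod>i\<in>f ` T. A i (map_permutation T f p i)) = (\<Prod>i\<in>T. A (f i) (f (p i)))"
      using f by (simp add: prod.reindex map_permutation_def restrict_id_def inv_into_f_f)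
    then show "of_int (sign (map_permutation T f p)) * (\<Prod>i\<in>f ` T. A i (map_permutation T f p i))
        = of_int (sign p) * (\<Prod>i\<in>T. A (f i) (f (p i)))"
      by (simp add: sign_map_permutation[OF f p T])
  qed
  finally show ?thesis .
qed

lemma kdet_eq_pminor: "inj_on x {..<n} \<Longrightarrow> kdet A n x = pminor A (x ` {..<n})"
  by (subst pminor_image) (simp_all add: kdet_def pminor_def)

text \<open>Tuples with a repetition contribute 0, and a subset of size n has n! enumerations with
  the same minor. This is what the 1/n! of the Fredholm series cancels.\<close>

lemma sum_kdet_eq_pminor:
  assumes M: "finite M"
  shows "(\<Sum>l\<in>PiE {..<n} (\<lambda>_. M). kdet A n l) = fact n * (\<Sum>S | S \<subseteq> M \<and> card S = n. pminor A S)"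
proof -
  let ?PM = "PiE {..<n} (\<lambda>_. M)"
  let ?I = "{l \<in> ?PM. inj_on l {..<n}}"
  let ?T = "{S. S \<subseteq> M \<and> card S = n}"
  have fin: "finite ?PM" "finite ?T" using M by (auto simp: finite_PiE)
  have "(\<Sum>l\<in>?PM. kdet A n l) = (\<Sum>l\<in>?I. kdet A n l)"
    using fin by (intro sum.mono_neutral_right) (auto simp: kdet_not_inj)
  also have "\<dots> = (\<Sum>S\<in>?T. \<Sum>l\<in>{l \<in> ?I. l ` {..<n} = S}. kdet A n l)"
  proof (rule sum.group[of ?I ?T "\<lambda>l. l ` {..<n}" "kdet A n", symmetric])
    show "finite ?I" using fin(1) by simp
    show "(\<lambda>l. l ` {..<n}) ` ?I \<subseteq> ?T"
    proof (rule image_subsetI)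
      fix l assume "l \<in> ?I"
      then have "l \<in> ?PM" "inj_on l {..<n}" by auto
      then show "l ` {..<n} \<in> ?T" using card_image[of l "{..<n}"] by auto
    qed
  qed (rule fin(2))
  also have "\<dots> = (\<Sum>S\<in>?T. fact n * pminor A S)"
  proof (intro sum.cong refl)
    fix S assume S: "S \<in> ?T"
    then have finS: "finite S" using M finite_subset by blast
    have "{l \<in> ?I. l ` {..<n} = S} = {l \<in> {..<n} \<rightarrow>\<^sub>E S. inj_on l {..<n}}"
    proof (intro Set.set_eqI iffI)
      fix l assume "l \<in> {l \<in> {..<n} \<rightarrow>\<^sub>E S. inj_on l {..<n}}"
      then have l: "l \<in> {..<n} \<rightarrow>\<^sub>E S" "inj_on l {..<n}" by auto
      then have "l ` {..<n} = S"
        using S finS by (intro card_subset_eq) (auto simp: card_image)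
      then show "l \<in> {l \<in> ?I. l ` {..<n} = S}" using l S by (auto simp: PiE_iff)
    qed (auto simp: PiE_iff)
    then have "card {l \<in> ?I. l ` {..<n} = S} = fact n"
      using S finS card_inj_on_subset_funcset[of "{..<n}" S "{..<n}"] by (simp add: fact_prod_rev)
    then show "(\<Sum>l\<in>{l \<in> ?I. l ` {..<n} = S}. kdet A n l) = fact n * pminor A S"
      by (subst sum.cong[OF refl, of _ _ "\<lambda>_. pminor A S"]) (auto simp: kdet_eq_pminor)
  qed
  finally show ?thesis by (simp add: sum_distrib_left)
qed

text \<open>Expand every factor and let \<open>S\<close> collect the indices where - A was chosen.
  At the other indices the Kronecker delta forces fixed points, so only permutations of
  \<open>S\<close> survive.\<close>

lemma pminor_id_minus:
  assumes M: "finite M"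
  shows "pminor (\<lambda>i j. (if i = j then 1 else 0) - A i j) M = (\<Sum>S\<in>Pow M. (-1) ^ card S * pminor A S)"
proof -
  have "pminor (\<lambda>i j. (if i = j then 1 else 0) - A i j) M
      = (\<Sum>p | p permutes M. \<Sum>S\<in>Pow M. of_int (sign p) *
          ((\<Prod>i\<in>S. - A i (p i)) * (\<Prod>i\<in>M - S. if i = p i then 1 else 0)))"
    unfolding pminor_def sum_distrib_left[symmetric] prod_add[OF M, symmetric] by simp
  also have "\<dots> = (\<Sum>S\<in>Pow M. \<Sum>p | p permutes M. of_int (sign p) *
          ((\<Prod>i\<in>S. - A i (p i)) * (\<Prod>i\<in>M - S. if i = p i then 1 else 0)))"
    by (rule sum.swap)
  also have "\<dots> = (\<Sum>S\<in>Pow M. (-1) ^ card S * pminor A S)"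
  proof (intro sum.cong refl)
    fix S assume "S \<in> Pow M"
    then have S: "S \<subseteq> M" by simp
    have "(\<Sum>p | p permutes M. of_int (sign p) *
          ((\<Prod>i\<in>S. - A i (p i)) * (\<Prod>i\<in>M - S. if i = p i then 1 else 0)))
        = (\<Sum>p | p permutes S. of_int (sign p) *
          ((\<Prod>i\<in>S. - A i (p i)) * (\<Prod>i\<in>M - S. if i = p i then 1 else 0)))"
    proof (rule sum.mono_neutral_right)
      show "finite {p. p permutes M}" using M by (rule finite_permutations)
      show "{p. p permutes S} \<subseteq> {p. p permutes M}" using permutes_subset[OF _ S] by blast
      show "\<forall>p\<in>{p. p permutes M} - {p. p permutes S}. of_int (sign p) *
          ((\<Prod>i\<in>S. - A i (p i)) * (\<Prod>i\<in>M - S. if i = p i then 1 else 0)) = 0"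
      proof
        fix p assume "p \<in> {p. p permutes M} - {p. p permutes S}"
        then obtain x where "x \<in> M - S" "p x \<noteq> x" using permutes_superset[of p M S] by blast
        then have "(\<Prod>i\<in>M - S. if i = p i then 1 else 0 :: real) = 0"
          using M by (intro prod_zero bexI[of _ x]) auto
        then show "of_int (sign p) *
          ((\<Prod>i\<in>S. - A i (p i)) * (\<Prod>i\<in>M - S. if i = p i then 1 else 0)) = 0" by simp
      qed
    qed
    also have "\<dots> = (\<Sum>p | p permutes S. (-1) ^ card S * (of_int (sign p) * (\<Prod>i\<in>S. A i (p i))))"
    proof (intro sum.cong refl)
      fix p assume "p \<in> {p. p permutes S}"
      then have "(\<Prod>i\<in>M - S. if i = p i then 1 else 0 :: real) = 1"
        using permutes_not_in[of p S] by (intro prod.neutral) auto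
      moreover have "(\<Prod>i\<in>S. - A i (p i)) = (-1) ^ card S * (\<Prod>i\<in>S. A i (p i))"
        using prod.distrib[of "\<lambda>_. -1" "\<lambda>i. A i (p i)" S] by simp
      ultimately show "of_int (sign p) *
          ((\<Prod>i\<in>S. - A i (p i)) * (\<Prod>i\<in>M - S. if i = p i then 1 else 0))
          = (-1) ^ card S * (of_int (sign p) * (\<Prod>i\<in>S. A i (p i)))"
        by simp
    qed
    finally show "(\<Sum>p | p permutes M. of_int (sign p) *
          ((\<Prod>i\<in>S. - A i (p i)) * (\<Prod>i\<in>M - S. if i = p i then 1 else 0)))
        = (-1) ^ card S * pminor A S"
      by (simp add: pminor_def sum_distrib_left)
  qed
  finally show ?thesis .
qed

lemma suminf_kdet_eq_det:
  assumes e: "bij_betw e {..<m} M"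
  shows "(\<Sum>n. (-1) ^ n / fact n * (\<Sum>l\<in>PiE {..<n} (\<lambda>_. M). kdet A n l))
    = Determinant.det (Matrix.mat m m (\<lambda>(i, j). (if i = j then 1 else 0) - A (e i) (e j)))"
proof -
  have M: "finite M" "card M = m" using e bij_betw_finite bij_betw_same_card by fastforce+
  have inj: "inj_on e {..<m}" and im: "e ` {..<m} = M" using e by (auto simp: bij_betw_def)
  let ?T = "\<lambda>n. {S. S \<subseteq> M \<and> card S = n}"
  have "(\<Sum>n. (-1) ^ n / fact n * (\<Sum>l\<in>PiE {..<n} (\<lambda>_. M). kdet A n l))
      = (\<Sum>n. (-1) ^ n * (\<Sum>S\<in>?T n. pminor A S))"
    by (simp add: sum_kdet_eq_pminor[OF M(1)])
  also have "\<dots> = (\<Sum>n\<le>m. (-1) ^ n * (\<Sum>S\<in>?T n. pminor A S))"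
  proof (rule suminf_finite)
    fix n assume "n \<notin> {..m}"
    then have *: "?T n = {}" using M card_mono[OF M(1)] by fastforce
    show "(-1) ^ n * (\<Sum>S\<in>?T n. pminor A S) = 0" unfolding * by simp
  qed simp
  also have "\<dots> = (\<Sum>n\<le>m. \<Sum>S\<in>{S \<in> Pow M. card S = n}. (-1) ^ card S * pminor A S)"
    by (intro sum.cong refl) (auto simp: sum_distrib_left intro!: sum.cong)
  also have "\<dots> = (\<Sum>S\<in>Pow M. (-1) ^ card S * pminor A S)"
    using M card_mono[OF M(1)] by (intro sum.group[of "Pow M" "{..m}" card]) auto
  also have "\<dots> = pminor (\<lambda>i j. (if i = j then 1 else 0) - A i j) (e ` {..<m})"
    using pminor_id_minus[OF M(1)] im by simp
  also have "\<dots> = pminor (\<lambda>i j. (if e i = e j then 1 else 0) - A (e i) (e j)) {..<m}"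
    using inj by (simp add: pminor_image)
  also have "\<dots> = Determinant.det (Matrix.mat m m (\<lambda>(i, j). (if i = j then 1 else 0) - A (e i) (e j)))"
  proof -
    have pl: "p i < m" if "p permutes {0..<m}" "i < m" for p i
      using permutes_in_image[OF that(1), of i] that(2) by simp
    show ?thesis
      unfolding pminor_def lessThan_atLeast0
      by (subst det_def'[of _ m])
        (auto simp: pl inj_on_eq_iff[OF inj] lessThan_atLeast0 intro!: sum.cong prod.cong)
  qed
  finally show ?thesis .
qed

text \<open>Each index occurs once as a row and once as a column, hence contributes sqrt(sigma)
  twice. The weight is split symmetrically because \<open>toda_finite\<close> works with a symmetric
  matrix.\<close>

lemma kdet_sqrt_conj:
  assumes "\<And>i. i < n \<Longrightarrow> \<sigma> (l i) \<ge> 0"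
  shows "(\<Prod>i<n. \<sigma> (l i)) * kdet A n l = kdet (\<lambda>x y. sqrt (\<sigma> x) * A x y * sqrt (\<sigma> y)) n l"
  unfolding kdet_def sum_distrib_left
proof (intro sum.cong refl)
  fix p assume "p \<in> {p. p permutes {..<n}}"
  then have p: "p permutes {..<n}" by simp
  have "(\<Prod>i<n. sqrt (\<sigma> (l i)) * A (l i) (l (p i)) * sqrt (\<sigma> (l (p i))))
      = (\<Prod>i<n. sqrt (\<sigma> (l i))) * (\<Prod>i<n. A (l i) (l (p i))) * (\<Prod>i<n. sqrt (\<sigma> (l (p i))))"
    by (simp add: prod.distrib)
  also have "(\<Prod>i<n. sqrt (\<sigma> (l (p i)))) = (\<Prod>i<n. sqrt (\<sigma> (l i)))"
    using prod.permute[OF p, of "\<lambda>i. sqrt (\<sigma> (l i))"] by (simp add: o_def)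
  also have "(\<Prod>i<n. sqrt (\<sigma> (l i))) * (\<Prod>i<n. A (l i) (l (p i))) * (\<Prod>i<n. sqrt (\<sigma> (l i)))
      = (\<Prod>i<n. sqrt (\<sigma> (l i)) * sqrt (\<sigma> (l i))) * (\<Prod>i<n. A (l i) (l (p i)))"
    by (simp only: prod.distrib mult_ac)
  also have "(\<Prod>i<n. sqrt (\<sigma> (l i)) * sqrt (\<sigma> (l i))) = (\<Prod>i<n. \<sigma> (l i))"
    using assms by (intro prod.cong) auto
  finally show "(\<Prod>i<n. \<sigma> (l i)) * (of_int (sign p) * (\<Prod>i<n. A (l i) (l (p i)))) =
      of_int (sign p) * (\<Prod>i<n. sqrt (\<sigma> (l i)) * A (l i) (l (p i)) * sqrt (\<sigma> (l (p i))))"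
    by simp
qed

lemma fredholm_series_finite:
  assumes e: "bij_betw e {..<m} M" and M: "M \<subseteq> Y" "\<And>y. y \<in> Y - M \<Longrightarrow> \<sigma> y = 0"
    and \<sigma>: "\<And>y. y \<in> Y \<Longrightarrow> \<sigma> y \<ge> 0"
  shows "fredholm_series \<sigma> A Y = Determinant.det (Matrix.mat m m
    (\<lambda>(i, j). (if i = j then 1 else 0) - sqrt (\<sigma> (e i)) * A (e i) (e j) * sqrt (\<sigma> (e j))))"
proof -
  let ?B = "\<lambda>x y. sqrt (\<sigma> x) * A x y * sqrt (\<sigma> y)"
  have finM: "finite M" using e bij_betw_finite by blast
  have "(\<Sum>\<^sub>\<infinity>l\<in>PiE {..<n} (\<lambda>_. Y). (\<Prod>i<n. \<sigma> (l i)) * kdet A n l) = (\<Sum>l\<in>PiE {..<n} (\<lambda>_. M). kdet ?B n l)" for n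
  proof -
    have "(\<Sum>\<^sub>\<infinity>l\<in>PiE {..<n} (\<lambda>_. Y). (\<Prod>i<n. \<sigma> (l i)) * kdet A n l)
        = (\<Sum>\<^sub>\<infinity>l\<in>PiE {..<n} (\<lambda>_. M). kdet ?B n l)"
    proof (rule infsum_cong_neutral)
      fix l assume "l \<in> PiE {..<n} (\<lambda>_. M) - PiE {..<n} (\<lambda>_. Y)"
      then show "kdet ?B n l = 0" using M(1) by (auto simp: PiE_iff)
    next
      fix l assume l: "l \<in> PiE {..<n} (\<lambda>_. Y) - PiE {..<n} (\<lambda>_. M)"
      then obtain i where "i < n" "l i \<notin> M" by (auto simp: PiE_iff)
      with l M(2) have "\<exists>i\<in>{..<n}. \<sigma> (l i) = 0" by (auto simp: PiE_iff)
      then show "(\<Prod>i<n. \<sigma> (l i)) * kdet A n l = 0" by simp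
    next
      fix l assume "l \<in> PiE {..<n} (\<lambda>_. Y) \<inter> PiE {..<n} (\<lambda>_. M)"
      then show "(\<Prod>i<n. \<sigma> (l i)) * kdet A n l = kdet ?B n l"
        using \<sigma> by (intro kdet_sqrt_conj) (auto simp: PiE_iff)
    qed
    then show ?thesis using finM by (simp add: finite_PiE)
  qed
  then show ?thesis
    unfolding fredholm_series_def using suminf_kdet_eq_det[OF e, of ?B] by simp
qed

section \<open>The discrete Bessel kernel\<close>

lemma Zh_add_Ints: "x \<in> Zh \<Longrightarrow> l \<in> Zh \<Longrightarrow> x + l \<in> \<int>"
proof -
  assume "x \<in> Zh" "l \<in> Zh"
  then obtain i j :: int where "x = of_int i + 1/2" "l = of_int j + 1/2" by (auto simp: Zh_def)
  then have "x + l = of_int (i + j + 1)" by simp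
  then show ?thesis by (metis Ints_of_int)
qed

lemma Zh_add_int: "x \<in> Zh \<Longrightarrow> x + of_int k \<in> Zh"
proof -
  assume "x \<in> Zh"
  then obtain i :: int where "x = of_int i + 1/2" by (auto simp: Zh_def)
  then have "x + of_int k = of_int (i + k) + 1/2" by simp
  then show ?thesis unfolding Zh_def by blast
qed

lemma Zh_add_1: "s \<in> Zh \<Longrightarrow> s + 1 \<in> Zh" and Zh_diff_1: "s \<in> Zh \<Longrightarrow> s - 1 \<in> Zh"
  using Zh_add_int[of s 1] Zh_add_int[of s "-1"] by simp_all

lemma bij_betw_half_line:
  assumes "s \<in> Zh"
  shows "bij_betw (\<lambda>n::nat. s + real (Suc n)) UNIV {y \<in> Zh. y > s}"
proof (rule bij_betw_imageI)
  show "range (\<lambda>n::nat. s + real (Suc n)) = {y \<in> Zh. y > s}"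
  proof (intro equalityI subsetI)
    fix y assume "y \<in> range (\<lambda>n::nat. s + real (Suc n))"
    then obtain n where y: "y = s + real (Suc n)" by auto
    then show "y \<in> {y \<in> Zh. y > s}" using Zh_add_int[OF assms, of "int (Suc n)"] by simp
  next
    fix y assume y: "y \<in> {y \<in> Zh. y > s}"
    obtain i :: int where i: "s = of_int i + 1/2" using assms by (auto simp: Zh_def)
    obtain j :: int where j: "y = of_int j + 1/2" using y by (auto simp: Zh_def)
    have "i < j" using y i j by simp
    then have "y = s + real (Suc (nat (j - i - 1)))" using i j by simp
    then show "y \<in> range (\<lambda>n::nat. s + real (Suc n))" by blast
  qed
qed (simp add: inj_on_def)

lemma sum_geom_weight_shift_le:
  assumes "finite F" "F \<subseteq> Zh" "l \<in> Zh"
  shows "(\<Sum>x\<in>F. geom_weight (x + l)) \<le> 4"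
proof -
  have "(\<Sum>x\<in>F. geom_weight (x + l)) = (\<Sum>a\<in>(\<lambda>x. x + l) ` F. geom_weight a)"
    by (simp add: sum.reindex)
  also have "\<dots> \<le> 4"
    using assms Zh_add_Ints by (intro sum_geom_weight_le) auto
  finally show ?thesis .
qed

lemma summable_geom_weight:
  assumes "X \<subseteq> Zh" "l \<in> Zh"
  shows "(\<lambda>x. geom_weight (x + l)) summable_on X"
    and "(\<Sum>\<^sub>\<infinity>x\<in>X. geom_weight (x + l)) \<le> 4"
proof -
  show s: "(\<lambda>x. geom_weight (x + l)) summable_on X"
  proof (rule nonneg_bdd_above_summable_on)
    show "bdd_above (sum (\<lambda>x. geom_weight (x + l)) ` {F. F \<subseteq> X \<and> finite F})"
      using assms by (intro bdd_aboveI2[of _ _ 4] sum_geom_weight_shift_le) auto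
  qed (simp add: geom_weight_pos less_imp_le)
  show "(\<Sum>\<^sub>\<infinity>x\<in>X. geom_weight (x + l)) \<le> 4"
    using assms by (intro infsum_le_finite_sums[OF s] sum_geom_weight_shift_le) auto
qed

text \<open>Lowering a half-integer by 1/2 keeps its floor. Since -1/2 lies in \<open>Zh\<close>,
  the summability of translated weights thereby covers \<open>geom_weight\<close> itself.\<close>

lemma geom_weight_Zh: "l \<in> Zh \<Longrightarrow> geom_weight (l + - 1/2) = geom_weight l"
proof -
  assume "l \<in> Zh"
  then obtain i :: int where i: "l = of_int i + 1/2" by (auto simp: Zh_def)
  have "\<lfloor>l\<rfloor> = i" unfolding i by linarith
  moreover have "\<lfloor>l + - 1/2\<rfloor> = i" by (simp add: i)
  ultimately show ?thesis by (simp add: geom_weight_def)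
qed

lemma summable_geom_weight_Zh: "X \<subseteq> Zh \<Longrightarrow> geom_weight summable_on X"
proof -
  assume X: "X \<subseteq> Zh"
  have "- 1/2 \<in> Zh" unfolding Zh_def by (rule CollectI, rule exI[of _ "-1"]) simp
  from summable_geom_weight(1)[OF X this] show ?thesis
    by (rule summable_on_cong[THEN iffD1, rotated]) (use X geom_weight_Zh in auto)
qed

text \<open>Up to a constant a majorant of the row sums of B_s. Its summability against sigma takes
  the place of the trace class property.\<close>

definition half_weight :: "real \<Rightarrow> real \<Rightarrow> real" where
  "half_weight s l = (\<Sum>\<^sub>\<infinity>x\<in>{y \<in> Zh. y > s}. geom_weight (x + l))"

lemma half_weight_nonneg: "half_weight s l \<ge> 0"
  unfolding half_weight_def by (intro infsum_nonneg) (simp add: geom_weight_pos less_imp_le)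

text \<open>For x > 0 the exponents add, up to the rounding of the floors. For s < x < 0 they miss
  by at most twice the absolute value of the floor of \<open>s\<close>, whence the power of
  4.\<close>

lemma geom_weight_add_le:
  assumes "s \<in> Zh" "x \<in> Zh" "l \<in> Zh" "x > s" "l > 0"
  shows "geom_weight (x + l) \<le> 4 ^ nat \<bar>\<lfloor>s\<rfloor>\<bar> * (geom_weight l * geom_weight x)"
proof -
  obtain i j k :: int where e: "s = of_int i + 1/2" "x = of_int j + 1/2" "l = of_int k + 1/2"
    using assms by (auto simp: Zh_def)
  have ijk: "j > i" "k \<ge> 0" using assms e by auto
  have f: "\<lfloor>s\<rfloor> = i" "\<lfloor>x\<rfloor> = j" "\<lfloor>l\<rfloor> = k" "\<lfloor>x + l\<rfloor> = j + k + 1"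
    unfolding e by linarith+
  let ?a = "nat \<bar>j + k + 1\<bar>" and ?c = "nat \<bar>i\<bar>"
  have "nat \<bar>k\<bar> + nat \<bar>j\<bar> \<le> ?a + 2 * ?c" using ijk by linarith
  then have "(1/2::real) ^ (?a + 2 * ?c) \<le> (1/2) ^ (nat \<bar>k\<bar> + nat \<bar>j\<bar>)"
    by (intro power_decreasing) auto
  then have "4 ^ ?c * (1/2::real) ^ (?a + 2 * ?c) \<le> 4 ^ ?c * ((1/2) ^ nat \<bar>k\<bar> * (1/2) ^ nat \<bar>j\<bar>)"
    by (simp add: power_add)
  moreover have "4 ^ ?c * (1/2::real) ^ (?a + 2 * ?c) = (1/2) ^ ?a"
  proof -
    have "(1/2::real) ^ (2 * ?c) = (1/4) ^ ?c" by (simp only: power_mult) (simp add: power2_eq_square)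
    moreover have "4 ^ ?c * (1/4::real) ^ ?c = 1" by (simp flip: power_mult_distrib)
    ultimately show ?thesis by (simp only: power_add mult.left_commute) simp
  qed
  ultimately show ?thesis by (simp add: geom_weight_def f)
qed

lemma half_weight_le:
  assumes "s \<in> Zh" "l \<in> Zh"
  shows "half_weight s l \<le> 4"
    and "l > 0 \<Longrightarrow> half_weight s l \<le> 4 ^ nat \<bar>\<lfloor>s\<rfloor>\<bar> * (\<Sum>\<^sub>\<infinity>x\<in>Zh. geom_weight x) * geom_weight l"
proof -
  show "half_weight s l \<le> 4"
    unfolding half_weight_def using assms by (intro summable_geom_weight) auto
  assume l: "l > 0"
  let ?X = "{y \<in> Zh. y > s}" and ?c = "4 ^ nat \<bar>\<lfloor>s\<rfloor>\<bar> * geom_weight l"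
  have "half_weight s l \<le> (\<Sum>\<^sub>\<infinity>x\<in>?X. ?c * geom_weight x)"
    unfolding half_weight_def
  proof (rule infsum_mono)
    show "(\<lambda>x. geom_weight (x + l)) summable_on ?X" using assms by (intro summable_geom_weight) auto
    show "(\<lambda>x. ?c * geom_weight x) summable_on ?X"
      by (intro summable_on_cmult_right summable_geom_weight_Zh) auto
    show "geom_weight (x + l) \<le> ?c * geom_weight x" if "x \<in> ?X" for x
      using geom_weight_add_le[of s x l] that assms l by (simp add: mult.assoc)
  qed
  also have "\<dots> = ?c * (\<Sum>\<^sub>\<infinity>x\<in>?X. geom_weight x)" by (rule infsum_cmult_right')
  also have "\<dots> \<le> ?c * (\<Sum>\<^sub>\<infinity>x\<in>Zh. geom_weight x)"
    by (intro mult_left_mono infsum_mono_neutral summable_geom_weight_Zh)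
      (auto simp: geom_weight_pos less_imp_le)
  finally show "half_weight s l \<le> 4 ^ nat \<bar>\<lfloor>s\<rfloor>\<bar> * (\<Sum>\<^sub>\<infinity>x\<in>Zh. geom_weight x) * geom_weight l"
    by (simp add: mult_ac)
qed

definition admissible :: "(real \<Rightarrow> real) \<Rightarrow> bool" where
  "admissible \<sigma> \<longleftrightarrow> (\<forall>l\<in>Zh. 0 \<le> \<sigma> l \<and> \<sigma> l \<le> 1) \<and> \<sigma> summable_on {l \<in> Zh. l < 0}"

text \<open>The two half-lines use different facts: for l < 0 the weight is merely bounded but sigma
  is summable, for l > 0 sigma is merely bounded by 1 but the weight decays geometrically.\<close>

lemma summable_half_weight:
  assumes \<sigma>: "admissible \<sigma>" and s: "s \<in> Zh"
  shows "(\<lambda>l. \<sigma> l * half_weight s l) summable_on Zh"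
proof -
  have neg: "(\<lambda>l. \<sigma> l * half_weight s l) summable_on {l \<in> Zh. l < 0}"
  proof (rule summable_on_comparison_test)
    show "(\<lambda>l. 4 * \<sigma> l) summable_on {l \<in> Zh. l < 0}"
      using \<sigma> by (intro summable_on_cmult_right) (simp add: admissible_def)
    fix l assume l: "l \<in> {l \<in> Zh. l < 0}"
    then have "\<sigma> l \<ge> 0" using \<sigma> by (simp add: admissible_def)
    then show "\<sigma> l * half_weight s l \<le> 4 * \<sigma> l"
      using mult_left_mono[OF half_weight_le(1)[OF s, of l]] l by (simp add: mult.commute)
    show "0 \<le> \<sigma> l * half_weight s l" using \<open>\<sigma> l \<ge> 0\<close> half_weight_nonneg by simp
  qed
  have pos: "(\<lambda>l. \<sigma> l * half_weight s l) summable_on {l \<in> Zh. l > 0}"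
  proof (rule summable_on_comparison_test)
    let ?c = "4 ^ nat \<bar>\<lfloor>s\<rfloor>\<bar> * (\<Sum>\<^sub>\<infinity>x\<in>Zh. geom_weight x)"
    show "(\<lambda>l. ?c * geom_weight l) summable_on {l \<in> Zh. l > 0}"
      by (intro summable_on_cmult_right summable_geom_weight_Zh) auto
    fix l assume l: "l \<in> {l \<in> Zh. l > 0}"
    then have \<sigma>l: "\<sigma> l \<ge> 0" "\<sigma> l \<le> 1" using \<sigma> by (simp_all add: admissible_def)
    have "\<sigma> l * half_weight s l \<le> 1 * half_weight s l"
      using \<sigma>l half_weight_nonneg by (intro mult_right_mono) auto
    then show "\<sigma> l * half_weight s l \<le> ?c * geom_weight l"
      using half_weight_le(2)[OF s, of l] l by simp
    show "0 \<le> \<sigma> l * half_weight s l" using \<sigma>l half_weight_nonneg by simp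
  qed
  have "0 \<notin> Zh"
  proof
    assume "0 \<in> Zh"
    then obtain i :: int where "0 = real_of_int i + 1/2" by (auto simp: Zh_def)
    then have "of_int (2 * i + 1) = (0::real)" by simp
    then have "2 * i + 1 = 0" by (simp only: of_int_eq_0_iff)
    then show False by presburger
  qed
  then have "l < 0 \<or> l > 0" if "l \<in> Zh" for l using that by (cases "l = 0") auto
  then have *: "Zh = {l \<in> Zh. l < 0} \<union> {l \<in> Zh. l > 0}" by blast
  show ?thesis by (subst *, rule summable_on_Un_disjoint[OF neg pos]) auto
qed

section \<open>The kernel B_s and the dual form of Q\<close>

definition bker :: "real \<Rightarrow> real \<Rightarrow> real \<Rightarrow> real \<Rightarrow> real" where
  "bker s t l l' = (\<Sum>\<^sub>\<infinity>x\<in>{y \<in> Zh. y > s}. besselJ (x + l) (2 * t) * besselJ (x + l') (2 * t))"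

lemma besselJ_mult_bound:
  assumes "\<bar>t\<bar> \<le> r"
  shows "\<bar>besselJ a (2 * t) * besselJ b (2 * t)\<bar> \<le> (exp (2 * r + r\<^sup>2))\<^sup>2 * (geom_weight a * geom_weight b)"
proof -
  have "\<bar>besselJ a (2 * t) * besselJ b (2 * t)\<bar>
      \<le> (exp (2 * r + r\<^sup>2) * geom_weight a) * (exp (2 * r + r\<^sup>2) * geom_weight b)"
    unfolding abs_mult by (intro mult_mono besselJ_bound assms) (simp_all add: geom_weight_pos less_imp_le)
  then show ?thesis by (simp add: power2_eq_square mult_ac)
qed

lemma bker_summand_summable:
  assumes "l \<in> Zh" "l' \<in> Zh"
  shows "(\<lambda>x. besselJ (x + l) (2 * t) * besselJ (x + l') (2 * t)) abs_summable_on {y \<in> Zh. y > s}"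
proof (rule summable_on_comparison_test)
  let ?C = "(exp (2 * \<bar>t\<bar> + \<bar>t\<bar>\<^sup>2))\<^sup>2"
  show "(\<lambda>x. ?C * geom_weight (x + l)) summable_on {y \<in> Zh. y > s}"
    using assms by (intro summable_on_cmult_right summable_geom_weight) auto
  fix x
  have "?C * (geom_weight (x + l) * geom_weight (x + l')) \<le> ?C * (geom_weight (x + l) * 1)"
    by (intro mult_left_mono geom_weight_le_1) (simp_all add: geom_weight_pos less_imp_le)
  from order_trans[OF besselJ_mult_bound[OF order_refl] this]
  show "norm (besselJ (x + l) (2 * t) * besselJ (x + l') (2 * t)) \<le> ?C * geom_weight (x + l)"
    by simp
qed simp

text \<open>Sum over \<open>z\<close> first: a translated geometric weight sums to at most 4,
  whatever \<open>x\<close> is. What remains of the sum over \<open>x\<close> is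
  \<open>half_weight\<close>.\<close>

lemma bker_row_le:
  assumes t: "\<bar>t\<bar> \<le> r" and y: "y \<in> Zh" and F: "finite F" "F \<subseteq> Zh"
  shows "(\<Sum>z\<in>F. \<bar>bker s t y z\<bar>) \<le> 4 * (exp (2 * r + r\<^sup>2))\<^sup>2 * half_weight s y"
proof -
  let ?X = "{y \<in> Zh. y > s}" and ?C = "(exp (2 * r + r\<^sup>2))\<^sup>2"
  let ?J = "\<lambda>z x. \<bar>besselJ (x + y) (2 * t) * besselJ (x + z) (2 * t)\<bar>"
  have J: "?J z summable_on ?X" if "z \<in> F" for z
    using bker_summand_summable[OF y, of z t s] that F by auto
  have "(\<Sum>z\<in>F. \<bar>bker s t y z\<bar>) \<le> (\<Sum>z\<in>F. \<Sum>\<^sub>\<infinity>x\<in>?X. ?J z x)"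
  proof (rule sum_mono)
    fix z assume "z \<in> F"
    then show "\<bar>bker s t y z\<bar> \<le> (\<Sum>\<^sub>\<infinity>x\<in>?X. ?J z x)"
      unfolding bker_def
      using norm_infsum_bound[OF bker_summand_summable[OF y, of z t s]] F by auto
  qed
  also have "\<dots> = (\<Sum>\<^sub>\<infinity>x\<in>?X. \<Sum>z\<in>F. ?J z x)"
    by (rule infsum_finite_sum(1)[OF F(1) J, symmetric])
  also have "\<dots> \<le> (\<Sum>\<^sub>\<infinity>x\<in>?X. 4 * ?C * geom_weight (x + y))"
  proof (rule infsum_mono)
    show "(\<lambda>x. \<Sum>z\<in>F. ?J z x) summable_on ?X" by (rule infsum_finite_sum(2)[OF F(1) J])
    show "(\<lambda>x. 4 * ?C * geom_weight (x + y)) summable_on ?X"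
      using y by (intro summable_on_cmult_right summable_geom_weight) auto
    fix x assume x: "x \<in> ?X"
    have "(\<Sum>z\<in>F. ?J z x) \<le> (\<Sum>z\<in>F. ?C * (geom_weight (x + y) * geom_weight (x + z)))"
      by (intro sum_mono besselJ_mult_bound t)
    also have "\<dots> = ?C * geom_weight (x + y) * (\<Sum>z\<in>F. geom_weight (z + x))"
      by (simp add: sum_distrib_left sum_distrib_right mult_ac add.commute)
    also have "\<dots> \<le> ?C * geom_weight (x + y) * 4"
      using F x by (intro mult_left_mono sum_geom_weight_shift_le) (auto simp: geom_weight_pos less_imp_le)
    finally show "(\<Sum>z\<in>F. ?J z x) \<le> 4 * ?C * geom_weight (x + y)" by simp
  qed
  also have "\<dots> = 4 * ?C * half_weight s y" unfolding half_weight_def by (rule infsum_cmult_right')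
  finally show ?thesis .
qed

text \<open>Duality with v_l(x) = J_{x+l}(2t). The Bessel bound reduces its hypothesis on the
  iterated sum to \<open>summable_half_weight\<close>.\<close>

lemma Qsig_eq_fredholm_series:
  assumes \<sigma>: "admissible \<sigma>" and s: "s \<in> Zh"
  shows "Qsig \<sigma> t s = fredholm_series \<sigma> (bker s t) Zh"
proof -
  let ?X = "{y \<in> Zh. y > s}" and ?C = "exp (2 * \<bar>t\<bar> + \<bar>t\<bar>\<^sup>2)"
  let ?v = "\<lambda>l x. besselJ (x + l) (2 * t)"
  have \<sigma>0: "\<sigma> l \<ge> 0" if "l \<in> Zh" for l using \<sigma> that by (simp add: admissible_def)
  have v: "\<bar>?v l x\<bar> \<le> ?C * geom_weight (x + l)" for l x by (intro besselJ_bound) simp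
  have S0: "(\<lambda>x. ?C * (\<sigma> l * geom_weight (x + l))) summable_on ?X" if "l \<in> Zh" for l
    using that by (intro summable_on_cmult_right summable_geom_weight) auto
  have le: "\<sigma> l * \<bar>?v l x\<bar> \<le> ?C * (\<sigma> l * geom_weight (x + l))" if "l \<in> Zh" for l x
    using mult_left_mono[OF v \<sigma>0[OF that]] by (simp add: mult_ac)
  have S1: "(\<lambda>x. \<sigma> l * \<bar>?v l x\<bar>) summable_on ?X" if "l \<in> Zh" for l
    by (rule summable_on_comparison_test[OF S0[OF that]]) (use that \<sigma>0 le in auto)
  have S2: "(\<lambda>l. \<Sum>\<^sub>\<infinity>x\<in>?X. \<sigma> l * \<bar>?v l x\<bar>) summable_on Zh"
  proof (rule summable_on_comparison_test)
    show "(\<lambda>l. ?C * (\<sigma> l * half_weight s l)) summable_on Zh"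
      by (intro summable_on_cmult_right summable_half_weight \<sigma> s)
    fix l assume l: "l \<in> Zh"
    have "(\<Sum>\<^sub>\<infinity>x\<in>?X. \<sigma> l * \<bar>?v l x\<bar>) \<le> (\<Sum>\<^sub>\<infinity>x\<in>?X. ?C * (\<sigma> l * geom_weight (x + l)))"
      by (intro infsum_mono S1 S0 le l)
    then show "(\<Sum>\<^sub>\<infinity>x\<in>?X. \<sigma> l * \<bar>?v l x\<bar>) \<le> ?C * (\<sigma> l * half_weight s l)"
      by (simp only: infsum_cmult_right' half_weight_def)
    show "0 \<le> (\<Sum>\<^sub>\<infinity>x\<in>?X. \<sigma> l * \<bar>?v l x\<bar>)" using \<sigma>0[OF l] by (intro infsum_nonneg) simp
  qed
  have "(\<Sum>\<^sub>\<infinity>x\<in>PiE {..<n} (\<lambda>_. ?X). kdet (Ksig \<sigma> t) n x)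
      = (\<Sum>\<^sub>\<infinity>l\<in>PiE {..<n} (\<lambda>_. Zh). (\<Prod>i<n. \<sigma> (l i)) * kdet (bker s t) n l)" for n
  proof -
    have "?C * geom_weight (x + l) \<le> ?C * 1" for x l by (intro mult_left_mono geom_weight_le_1) simp
    from order_trans[OF v this] have "\<bar>?v l x\<bar> \<le> ?C" for l x by simp
    then show ?thesis
      using infsum_kdet_duality[of Zh \<sigma> ?C ?X ?v n] \<sigma>0 S1 S2
      unfolding Ksig_def[abs_def] bker_def[abs_def] by simp
  qed
  then show ?thesis
    unfolding Qsig_def fredholm_det_def fredholm_series_def by simp
qed

section \<open>Shift, commutator and derivative of B_s\<close>

lemma bker_sums:
  assumes "s \<in> Zh" "l \<in> Zh" "l' \<in> Zh"
  shows "(\<lambda>n. besselJ (s + real (Suc n) + l) (2 * t) * besselJ (s + real (Suc n) + l') (2 * t)) sums bker s t l l'"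
proof -
  have "((\<lambda>x. besselJ (x + l) (2 * t) * besselJ (x + l') (2 * t)) has_sum bker s t l l') {y \<in> Zh. y > s}"
    unfolding bker_def
    by (rule has_sum_infsum[OF abs_summable_summable[OF bker_summand_summable[OF assms(2,3)]]])
  then have "((\<lambda>n. besselJ (s + real (Suc n) + l) (2 * t) * besselJ (s + real (Suc n) + l') (2 * t))
      has_sum bker s t l l') UNIV"
    by (rule has_sum_reindex_bij_betw[OF bij_betw_half_line[OF assms(1)],
          where f = "\<lambda>x. besselJ (x + l) (2 * t) * besselJ (x + l') (2 * t)", THEN iffD2])
  then show ?thesis by (rule has_sum_imp_sums)
qed

lemma geom_weight_half_line_tendsto_0:
  assumes "s \<in> Zh" "l \<in> Zh"
  shows "(\<lambda>n. geom_weight (s + real (Suc n) + l)) \<longlonglongrightarrow> 0"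
proof -
  have "(\<lambda>x. geom_weight (x + l)) summable_on {y \<in> Zh. y > s}"
    using assms by (intro summable_geom_weight) auto
  then have "(\<lambda>n. geom_weight (s + real (Suc n) + l)) summable_on UNIV"
    by (rule summable_on_reindex_bij_betw[OF bij_betw_half_line[OF assms(1)],
          where f = "\<lambda>x. geom_weight (x + l)", THEN iffD2])
  then show ?thesis by (intro summable_LIMSEQ_zero summable_on_imp_summable)
qed

lemma besselJ_tendsto_0:
  assumes "s \<in> Zh" "l \<in> Zh"
  shows "(\<lambda>n. besselJ (s + real n + l) (2 * t)) \<longlonglongrightarrow> 0"
proof -
  let ?C = "exp (2 * \<bar>t\<bar> + \<bar>t\<bar>\<^sup>2)"
  have "(\<lambda>n. besselJ (s + real (Suc n) + l) (2 * t)) \<longlonglongrightarrow> 0"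
  proof (rule Lim_null_comparison)
    show "(\<lambda>n. ?C * geom_weight (s + real (Suc n) + l)) \<longlonglongrightarrow> 0"
      using tendsto_mult_left[OF geom_weight_half_line_tendsto_0[OF assms], of ?C] by simp
    show "\<forall>\<^sub>F n in sequentially. norm (besselJ (s + real (Suc n) + l) (2 * t))
        \<le> ?C * geom_weight (s + real (Suc n) + l)"
      unfolding real_norm_def by (intro always_eventually allI besselJ_bound order_refl)
  qed
  then show ?thesis by (rule LIMSEQ_imp_Suc)
qed

lemma bker_sym: "bker s t l l' = bker s t l' l"
  by (simp add: bker_def mult.commute)

lemma bker_shift:
  assumes "s \<in> Zh" "l \<in> Zh" "l' \<in> Zh"
  shows "bker (s - 1) t l l' = bker s t l l' + besselJ (s + l) (2 * t) * besselJ (s + l') (2 * t)"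
proof -
  let ?f = "\<lambda>n. besselJ (s + real n + l) (2 * t) * besselJ (s + real n + l') (2 * t)"
  have "?f sums bker (s - 1) t l l'"
    using bker_sums[OF Zh_diff_1[OF assms(1)] assms(2,3), of t] by simp
  moreover have "?f sums (bker s t l l' + ?f 0)"
    using bker_sums[OF assms, of t] by (subst sums_Suc_iff[symmetric]) simp
  ultimately show ?thesis using sums_unique2 by fastforce
qed

text \<open>Write l - l' as (x + l) - (x + l') and apply the Bessel recurrence to each factor: the
  summand becomes t times a difference of consecutive Casoratians \<open>E\<close>. The sum
  telescopes to the first one, since the Bessel functions vanish as the order tends to
  infinity.\<close>

lemma bker_commutator:
  assumes "s \<in> Zh" "l \<in> Zh" "l' \<in> Zh"
  shows "(l - l') * bker s t l l' = t * (besselJ (s + l) (2 * t) * besselJ (s + 1 + l') (2 * t)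
     - besselJ (s + 1 + l) (2 * t) * besselJ (s + l') (2 * t))"
proof -
  define h where "h n = besselJ (s + real n + l) (2 * t)" for n
  define k where "k n = besselJ (s + real n + l') (2 * t)" for n
  define E where "E n = h n * k (Suc n) - h (Suc n) * k n" for n
  have rec: "t * (h n + h (Suc (Suc n))) = (s + real (Suc n) + l) * h (Suc n)"
    "t * (k n + k (Suc (Suc n))) = (s + real (Suc n) + l') * k (Suc n)" for n
  proof -
    have "s + real (Suc n) + l \<in> \<int>" "s + real (Suc n) + l' \<in> \<int>"
      using Zh_add_Ints[OF Zh_add_int[OF assms(1), of "int (Suc n)"]] assms by simp_all
    from besselJ_rec[OF this(1), of t] besselJ_rec[OF this(2), of t]
    show "t * (h n + h (Suc (Suc n))) = (s + real (Suc n) + l) * h (Suc n)"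
      "t * (k n + k (Suc (Suc n))) = (s + real (Suc n) + l') * k (Suc n)"
      by (simp_all add: h_def k_def algebra_simps)
  qed
  have step: "(l - l') * (h (Suc n) * k (Suc n)) = t * (E n - E (Suc n))" for n
  proof -
    have "(l - l') * (h (Suc n) * k (Suc n))
        = ((s + real (Suc n) + l) * h (Suc n)) * k (Suc n) - h (Suc n) * ((s + real (Suc n) + l') * k (Suc n))"
      by (simp add: algebra_simps)
    also have "\<dots> = t * (E n - E (Suc n))"
      unfolding rec[symmetric] E_def by (simp add: algebra_simps)
    finally show ?thesis .
  qed
  have lim: "h \<longlonglongrightarrow> 0" "k \<longlonglongrightarrow> 0"
    unfolding h_def k_def by (intro besselJ_tendsto_0 assms)+
  have "E \<longlonglongrightarrow> 0 * 0 - 0 * 0"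
    unfolding E_def by (intro tendsto_diff tendsto_mult lim LIMSEQ_Suc)
  then have "(\<lambda>n. E n - E (Suc n)) sums (E 0 - 0)" by (intro telescope_sums') simp
  then have "(\<lambda>n. t * (E n - E (Suc n))) sums (t * (E 0 - 0))" by (rule sums_mult)
  moreover have "(\<lambda>n. (l - l') * (h (Suc n) * k (Suc n))) sums ((l - l') * bker s t l l')"
    unfolding h_def k_def by (intro sums_mult bker_sums assms)
  ultimately have "(l - l') * bker s t l l' = t * E 0"
    unfolding step by (simp add: sums_unique2)
  then show ?thesis by (simp add: E_def h_def k_def)
qed

text \<open>With J_a(2t)' = J_{a-1} - J_{a+1} the derivatives of the partial sums telescope to
  \<open>G 0 - G n\<close>. The remainder \<open>G n\<close> has to vanish uniformly near the point,
  hence one radius \<open>r\<close>, larger than |t|, for all bounds.\<close>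

lemma bker_deriv:
  assumes "s \<in> Zh" "l \<in> Zh" "l' \<in> Zh"
  shows "((\<lambda>t. bker s t l l') has_real_derivative
     besselJ (s + l) (2 * t) * besselJ (s + 1 + l') (2 * t)
     + besselJ (s + 1 + l) (2 * t) * besselJ (s + l') (2 * t)) (at t)"
proof -
  define h where "h n t = besselJ (s + real n + l) (2 * t)" for n t
  define k where "k n t = besselJ (s + real n + l') (2 * t)" for n t
  define G where "G n t = h n t * k (Suc n) t + h (Suc n) t * k n t" for n t
  define r where "r = \<bar>t\<bar> + 1"
  define C where "C = (exp (2 * r + r\<^sup>2))\<^sup>2"
  let ?S = "{- r<..<r}"
  have dh: "(h (Suc n) has_real_derivative h n t - h (Suc (Suc n)) t) (at t)" for n t
    using besselJ_deriv[of "s + real (Suc n) + l" t] by (simp add: h_def[abs_def] algebra_simps)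
  have dk: "(k (Suc n) has_real_derivative k n t - k (Suc (Suc n)) t) (at t)" for n t
    using besselJ_deriv[of "s + real (Suc n) + l'" t] by (simp add: k_def[abs_def] algebra_simps)
  have df: "((\<lambda>t. \<Sum>i<n. h (Suc i) t * k (Suc i) t) has_real_derivative G 0 t - G n t) (at t)" for n t
  proof -
    have "((\<lambda>t. \<Sum>i<n. h (Suc i) t * k (Suc i) t) has_real_derivative
        (\<Sum>i<n. (h i t - h (Suc (Suc i)) t) * k (Suc i) t + (k i t - k (Suc (Suc i)) t) * h (Suc i) t)) (at t)"
      by (intro DERIV_sum DERIV_mult dh dk)
    also have "(\<Sum>i<n. (h i t - h (Suc (Suc i)) t) * k (Suc i) t + (k i t - k (Suc (Suc i)) t) * h (Suc i) t)
        = (\<Sum>i<n. G i t - G (Suc i) t)"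
      by (intro sum.cong refl) (simp add: G_def algebra_simps)
    also have "\<dots> = G 0 t - G n t" by (rule sum_lessThan_telescope')
    finally show ?thesis .
  qed
  define b where "b n = C * (geom_weight (s + real n + l) + geom_weight (s + real (Suc n) + l))" for n
  have Gb: "\<bar>G n x\<bar> \<le> b n" if "x \<in> ?S" for n x
  proof -
    have x: "\<bar>x\<bar> \<le> r" using that by auto
    have J: "\<bar>besselJ u (2 * x) * besselJ v (2 * x)\<bar> \<le> C * geom_weight u" for u v
    proof -
      have "C * (geom_weight u * geom_weight v) \<le> C * (geom_weight u * 1)"
        unfolding C_def by (intro mult_left_mono geom_weight_le_1) (simp_all add: geom_weight_pos less_imp_le)
      from order_trans[OF besselJ_mult_bound[OF x, folded C_def] this] show ?thesis by simp
    qed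
    have "\<bar>G n x\<bar> \<le> \<bar>h n x * k (Suc n) x\<bar> + \<bar>h (Suc n) x * k n x\<bar>"
      unfolding G_def by (rule abs_triangle_ineq)
    also have "\<dots> \<le> C * geom_weight (s + real n + l) + C * geom_weight (s + real (Suc n) + l)"
      unfolding h_def k_def by (intro add_mono J)
    finally show ?thesis by (simp add: b_def distrib_left)
  qed
  have "(\<lambda>n. geom_weight (s + real n + l)) \<longlonglongrightarrow> 0"
    using geom_weight_half_line_tendsto_0[OF assms(1,2)] by (rule LIMSEQ_imp_Suc)
  then have "b \<longlonglongrightarrow> C * (0 + 0)"
    unfolding b_def using geom_weight_half_line_tendsto_0[OF assms(1,2)]
    by (intro tendsto_mult tendsto_add tendsto_const)
  then have b: "b \<longlonglongrightarrow> 0" by simp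
  have unif: "uniform_limit ?S (\<lambda>n x. G 0 x - G n x) (G 0) sequentially"
  proof (rule uniform_limitI)
    fix e :: real assume "e > 0"
    then have "\<forall>\<^sub>F n in sequentially. b n < e" using b by (rule order_tendstoD(2)[rotated])
    then show "\<forall>\<^sub>F n in sequentially. \<forall>x\<in>?S. dist (G 0 x - G n x) (G 0 x) < e"
    proof eventually_elim
      case (elim n)
      then show ?case using Gb[of _ n] by (force simp: dist_real_def)
    qed
  qed
  have lim: "(\<lambda>n. \<Sum>i<n. h (Suc i) x * k (Suc i) x) \<longlonglongrightarrow> bker s x l l'" for x
    using bker_sums[OF assms, of x] by (simp add: sums_def h_def k_def)
  have "((\<lambda>t. bker s t l l') has_real_derivative G 0 t) (at t)"
    by (rule has_real_derivative_uniform_limit[where S = ?S, OF _ _ df unif lim]) (auto simp: r_def)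
  then show ?thesis by (simp add: G_def h_def k_def)
qed

text \<open>The recurrence trades one neighbour for a multiple of J_a. The first form, at order s +
  l, and the second, at order s + 1 + l, then make a closed first-order system for \<open>p\<close>
  and \<open>q\<close>.\<close>

lemma besselJ_deriv_low:
  assumes "a \<in> \<int>" "t > 0"
  shows "((\<lambda>t. besselJ a (2 * t)) has_real_derivative a / t * besselJ a (2 * t) - 2 * besselJ (a + 1) (2 * t)) (at t)"
    and "((\<lambda>t. besselJ a (2 * t)) has_real_derivative 2 * besselJ (a - 1) (2 * t) - a / t * besselJ a (2 * t)) (at t)"
proof -
  have "besselJ (a - 1) (2 * t) + besselJ (a + 1) (2 * t) = a / t * besselJ a (2 * t)"
    using besselJ_rec[OF assms(1), of t] assms(2) by (simp add: field_simps)
  then show "((\<lambda>t. besselJ a (2 * t)) has_real_derivative a / t * besselJ a (2 * t) - 2 * besselJ (a + 1) (2 * t)) (at t)"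
    and "((\<lambda>t. besselJ a (2 * t)) has_real_derivative 2 * besselJ (a - 1) (2 * t) - a / t * besselJ a (2 * t)) (at t)"
    using besselJ_deriv[of a t] by (auto intro: DERIV_cong)
qed

section \<open>Truncation of sigma\<close>

definition cutoff :: "nat \<Rightarrow> (real \<Rightarrow> real) \<Rightarrow> real \<Rightarrow> real" where
  "cutoff N \<sigma> l = (if \<bar>l\<bar> < real N then \<sigma> l else 0)"

lemma admissible_cutoff: "admissible \<sigma> \<Longrightarrow> admissible (cutoff N \<sigma>)"
proof -
  assume \<sigma>: "admissible \<sigma>"
  have "cutoff N \<sigma> summable_on {l \<in> Zh. l < 0}"
    by (rule summable_on_comparison_test[of \<sigma>]) (use \<sigma> in \<open>auto simp: admissible_def cutoff_def\<close>)
  then show ?thesis using \<sigma> by (auto simp: admissible_def cutoff_def)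
qed

lemma bij_betw_Zh_window: "bij_betw (\<lambda>i. real i - real N + 1/2) {..<2 * N} {l \<in> Zh. \<bar>l\<bar> < real N}"
proof (rule bij_betw_imageI)
  show "(\<lambda>i. real i - real N + 1/2) ` {..<2 * N} = {l \<in> Zh. \<bar>l\<bar> < real N}"
  proof (intro equalityI subsetI)
    fix l assume "l \<in> (\<lambda>i. real i - real N + 1/2) ` {..<2 * N}"
    then obtain i where i: "i < 2 * N" "l = real i - real N + 1/2" by auto
    then have "l = of_int (int i - int N) + 1/2" by simp
    then have "l \<in> Zh" unfolding Zh_def by blast
    moreover have "real i + 1 \<le> 2 * real N" using i(1) by linarith
    ultimately show "l \<in> {l \<in> Zh. \<bar>l\<bar> < real N}" using i(2) by (auto simp: abs_less_iff)
  next
    fix l assume l: "l \<in> {l \<in> Zh. \<bar>l\<bar> < real N}"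
    then obtain j :: int where j: "l = of_int j + 1/2" by (auto simp: Zh_def)
    have "of_int j < real N" "- real N - 1 < of_int j" using l j by auto
    then have "j < int N" "- int N \<le> j" by linarith+
    then have "nat (j + int N) \<in> {..<2 * N}" "l = real (nat (j + int N)) - real N + 1/2"
      using j by auto
    then show "l \<in> (\<lambda>i. real i - real N + 1/2) ` {..<2 * N}" by blast
  qed
qed (simp add: inj_on_def)

lemma finite_Zh_window: "finite {l \<in> Zh. \<bar>l\<bar> < real N}"
  using bij_betw_finite[OF bij_betw_Zh_window[of N]] by simp

text \<open>The error is at most exp W - exp (V N), which is free of \<open>t\<close> because
  \<open>w\<close> is built from the radius \<open>r\<close>. Uniformity thus reduces to V N tending
  to W.\<close>

lemma Qsig_cutoff_uniform:
  assumes \<sigma>: "admissible \<sigma>" and s: "s \<in> Zh"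
  shows "uniform_limit {- r..r} (\<lambda>N t. Qsig (cutoff N \<sigma>) t s) (\<lambda>t. Qsig \<sigma> t s) sequentially"
proof -
  define w where "w y = 4 * (exp (2 * r + r\<^sup>2))\<^sup>2 * half_weight s y" for y
  define W where "W = (\<Sum>\<^sub>\<infinity>y\<in>Zh. \<sigma> y * w y)"
  define V where "V N = (\<Sum>\<^sub>\<infinity>y\<in>Zh. cutoff N \<sigma> y * w y)" for N
  have sum: "(\<lambda>y. \<sigma> y * w y) summable_on Zh"
    using summable_on_cmult_right[OF summable_half_weight[OF \<sigma> s], of "4 * (exp (2 * r + r\<^sup>2))\<^sup>2"]
    by (simp add: w_def mult_ac)
  have "V \<longlonglongrightarrow> W"
  proof -
    let ?Z = "\<lambda>N. {l \<in> Zh. \<bar>l\<bar> < real N}"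
    have V: "V N = (\<Sum>y\<in>?Z N. \<sigma> y * w y)" for N
    proof -
      have "V N = (\<Sum>\<^sub>\<infinity>y\<in>?Z N. \<sigma> y * w y)"
        unfolding V_def by (rule infsum_cong_neutral) (auto simp: cutoff_def)
      then show ?thesis using finite_Zh_window by simp
    qed
    \<comment> \<open>The windows eventually contain every finite subset of \<open>Zh\<close>, so
      sums over them converge along the filter that defines \<open>has_sum\<close>.\<close>
    have "filterlim ?Z (finite_subsets_at_top Zh) sequentially"
      unfolding filterlim_finite_subsets_at_top
    proof (intro allI impI)
      fix F assume F: "finite F \<and> F \<subseteq> Zh"
      obtain b where b: "\<bar>l\<bar> \<le> b" if "l \<in> F" for l
        using finite_imp_bounded[of F] F by (auto simp: bounded_iff)
      have "\<forall>\<^sub>F N in sequentially. b < real N"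
        using filterlim_real_sequentially by (simp add: filterlim_at_top_dense)
      then show "\<forall>\<^sub>F N in sequentially. finite (?Z N) \<and> F \<subseteq> ?Z N \<and> ?Z N \<subseteq> Zh"
      proof eventually_elim
        case (elim N)
        have "F \<subseteq> ?Z N"
        proof
          fix l assume "l \<in> F"
          then show "l \<in> ?Z N" using b[of l] elim F by auto
        qed
        then show ?case using finite_Zh_window by auto
      qed
    qed
    moreover have "(sum (\<lambda>y. \<sigma> y * w y) \<longlongrightarrow> W) (finite_subsets_at_top Zh)"
      using has_sum_infsum[OF sum] unfolding has_sum_def W_def .
    ultimately show ?thesis
      unfolding V[abs_def] by (rule filterlim_compose[rotated])
  qed
  then have "(\<lambda>N. exp W - exp (V N)) \<longlonglongrightarrow> exp W - exp W" by (intro tendsto_intros)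
  then have lim: "(\<lambda>N. exp W - exp (V N)) \<longlonglongrightarrow> 0" by simp
  have le: "\<bar>Qsig \<sigma> t s - Qsig (cutoff N \<sigma>) t s\<bar> \<le> exp W - exp (V N)" if "t \<in> {- r..r}" for t N
    unfolding Qsig_eq_fredholm_series[OF \<sigma> s] Qsig_eq_fredholm_series[OF admissible_cutoff[OF \<sigma>] s] W_def V_def
  proof (rule fredholm_series_diff_le[OF _ _ sum])
    show "(\<Sum>z\<in>F. \<bar>bker s t y z\<bar>) \<le> w y" if "y \<in> Zh" "finite F" "F \<subseteq> Zh" for y F
      unfolding w_def using that \<open>t \<in> {- r..r}\<close> by (intro bker_row_le) auto
    show "0 \<le> cutoff N \<sigma> y \<and> cutoff N \<sigma> y \<le> \<sigma> y" if "y \<in> Zh" for y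
      using \<sigma> that by (auto simp: cutoff_def admissible_def)
  qed
  show ?thesis
  proof (rule uniform_limitI)
    fix e :: real assume "e > 0"
    then have "\<forall>\<^sub>F N in sequentially. exp W - exp (V N) < e" using lim by (rule order_tendstoD(2)[rotated])
    then show "\<forall>\<^sub>F N in sequentially. \<forall>t\<in>{- r..r}. dist (Qsig (cutoff N \<sigma>) t s) (Qsig \<sigma> t s) < e"
    proof eventually_elim
      case (elim N)
      show ?case
      proof
        fix t assume "t \<in> {- r..r}"
        from le[OF this, of N] elim show "dist (Qsig (cutoff N \<sigma>) t s) (Qsig \<sigma> t s) < e"
          by (simp add: dist_real_def abs_minus_commute)
      qed
    qed
  qed
qed

lemma Qsig_cutoff_eq_det:
  assumes "admissible \<sigma>" "s \<in> Zh"
  defines "e \<equiv> \<lambda>N i. real i - real N + 1/2"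
  shows "Qsig (cutoff N \<sigma>) t s = Determinant.det (Matrix.mat (2 * N) (2 * N) (\<lambda>(i, j). (if i = j then 1 else 0)
    - sqrt (cutoff N \<sigma> (e N i)) * bker s t (e N i) (e N j) * sqrt (cutoff N \<sigma> (e N j))))"
  unfolding Qsig_eq_fredholm_series[OF admissible_cutoff[OF assms(1)] assms(2)] e_def
  using admissible_cutoff[OF assms(1), of N]
  by (intro fredholm_series_finite[OF bij_betw_Zh_window]) (auto simp: admissible_def cutoff_def)

lemma Zh_window_mem: "real i - real N + 1/2 \<in> Zh"
proof -
  have "real i - real N + 1/2 = of_int (int i - int N) + 1/2" by simp
  then show ?thesis unfolding Zh_def by blast
qed

lemma Qsig_cutoff_continuous:
  assumes "admissible \<sigma>" "s \<in> Zh"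
  shows "continuous_on X (\<lambda>t. Qsig (cutoff N \<sigma>) t s)"
proof (rule DERIV_continuous_on, rule has_field_derivative_at_within)
  fix t
  let ?e = "\<lambda>i. real i - real N + 1/2"
  let ?B' = "\<lambda>i j. 0 - sqrt (cutoff N \<sigma> (?e i)) * (besselJ (s + ?e i) (2 * t) * besselJ (s + 1 + ?e j) (2 * t)
     + besselJ (s + 1 + ?e i) (2 * t) * besselJ (s + ?e j) (2 * t)) * sqrt (cutoff N \<sigma> (?e j))"
  show "((\<lambda>t. Qsig (cutoff N \<sigma>) t s) has_real_derivative (\<Sum>i<2 * N. \<Sum>j<2 * N. ?B' i j *
      cofactor (Matrix.mat (2 * N) (2 * N) (\<lambda>(i, j). (if i = j then 1 else 0)
        - sqrt (cutoff N \<sigma> (?e i)) * bker s t (?e i) (?e j) * sqrt (cutoff N \<sigma> (?e j)))) i j)) (at t)"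
    unfolding Qsig_cutoff_eq_det[OF assms]
  proof (rule has_real_derivative_det)
    fix i j
    show "((\<lambda>t. (if i = j then 1 else 0) - sqrt (cutoff N \<sigma> (?e i)) * bker s t (?e i) (?e j)
        * sqrt (cutoff N \<sigma> (?e j))) has_real_derivative ?B' i j) (at t)"
      by (intro DERIV_diff DERIV_const DERIV_cmult_right DERIV_cmult bker_deriv assms Zh_window_mem)
  qed
qed

text \<open>The factor sqrt(sigma) does not depend on \<open>t\<close>; it multiplies
  \<open>p\<close> and \<open>q\<close> once and B_s from both sides, so the identities for B_s
  carry over to the hypotheses of \<open>toda_finite\<close>.\<close>

lemma toda_cutoff:
  assumes \<sigma>: "admissible \<sigma>" and s: "s \<in> Zh" and S: "open S" "\<And>t. t \<in> S \<Longrightarrow> t > 0"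
    and pos: "\<And>t. t \<in> S \<Longrightarrow> Qsig (cutoff N \<sigma>) t s > 0"
  shows "\<exists>f'. \<forall>t\<in>S. ((\<lambda>t. ln (Qsig (cutoff N \<sigma>) t s)) has_real_derivative f' t) (at t) \<and>
    (f' has_real_derivative
      4 * (Qsig (cutoff N \<sigma>) t (s + 1) * Qsig (cutoff N \<sigma>) t (s - 1) / (Qsig (cutoff N \<sigma>) t s)\<^sup>2) - 4 - f' t / t) (at t)"
proof -
  define e where "e i = real i - real N + 1/2" for i
  define c where "c i = sqrt (cutoff N \<sigma> (e i))" for i
  define B where "B t i j = c i * bker s t (e i) (e j) * c j" for t i j
  define p where "p t i = c i * besselJ (s + e i) (2 * t)" for t i
  define q where "q t i = c i * besselJ (s + 1 + e i) (2 * t)" for t i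
  have e: "e i \<in> Zh" for i unfolding e_def by (rule Zh_window_mem)
  note s' = Zh_add_1[OF s] Zh_diff_1[OF s]
  have D: "Qsig (cutoff N \<sigma>) t s
      = Determinant.det (Matrix.mat (2 * N) (2 * N) (\<lambda>(i, j). (if i = j then 1 else 0) - B t i j))" for t
    unfolding Qsig_cutoff_eq_det[OF \<sigma> s] B_def c_def e_def ..
  have Dm: "Qsig (cutoff N \<sigma>) t (s - 1)
      = Determinant.det (Matrix.mat (2 * N) (2 * N) (\<lambda>(i, j). (if i = j then 1 else 0) - (B t i j + p t i * p t j)))" for t
    unfolding Qsig_cutoff_eq_det[OF \<sigma> s'(2)] e_def[symmetric] c_def[symmetric] bker_shift[OF s e e] B_def p_def
    by (simp add: algebra_simps)
  have Dp: "Qsig (cutoff N \<sigma>) t (s + 1)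
      = Determinant.det (Matrix.mat (2 * N) (2 * N) (\<lambda>(i, j). (if i = j then 1 else 0) - (B t i j - q t i * q t j)))" for t
  proof -
    \<comment> \<open>The downward shift, read from s + 1 to s.\<close>
    have *: "bker (s + 1) t (e i) (e j) = bker s t (e i) (e j)
        - besselJ (s + 1 + e i) (2 * t) * besselJ (s + 1 + e j) (2 * t)" for i j
      using bker_shift[OF s'(1) e e, of t i j] by simp
    show ?thesis
      unfolding Qsig_cutoff_eq_det[OF \<sigma> s'(1)] e_def[symmetric] c_def[symmetric] * B_def q_def
      by (simp add: algebra_simps)
  qed
  have Ints: "s + e i \<in> \<int>" "s + 1 + e i \<in> \<int>" for i
    using Zh_add_Ints[OF s e] Zh_add_Ints[OF s'(1) e] by auto
  show ?thesis
    unfolding D Dm Dp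
  proof (rule toda_finite[where l = e and s = s])
    show "open S" "\<And>t. t \<in> S \<Longrightarrow> 0 < t" by fact+
    show "0 < Determinant.det (Matrix.mat (2 * N) (2 * N) (\<lambda>(i, j). (if i = j then 1 else 0) - B t i j))"
      if "t \<in> S" for t using pos[OF that] unfolding D .
    show "B t i j = B t j i" for t i j
      by (simp add: B_def bker_sym[of s t "e i"] mult_ac)
    show "(e i - e j) * B t i j = t * (p t i * q t j - q t i * p t j)" for t i j
    proof -
      have "(e i - e j) * B t i j = c i * c j * ((e i - e j) * bker s t (e i) (e j))"
        by (simp add: B_def algebra_simps)
      then show ?thesis
        unfolding bker_commutator[OF s e e] by (simp add: p_def q_def algebra_simps)
    qed
    show "((\<lambda>t. B t i j) has_real_derivative p t i * q t j + q t i * p t j) (at t)" for t i j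
    proof -
      have "((\<lambda>t. B t i j) has_real_derivative
          c i * (besselJ (s + e i) (2 * t) * besselJ (s + 1 + e j) (2 * t)
            + besselJ (s + 1 + e i) (2 * t) * besselJ (s + e j) (2 * t)) * c j) (at t)"
        unfolding B_def by (intro DERIV_cmult_right DERIV_cmult bker_deriv s e)
      then show ?thesis by (rule DERIV_cong) (simp add: p_def q_def algebra_simps)
    qed
    show "((\<lambda>t. p t i) has_real_derivative (s + e i) / t * p t i - 2 * q t i) (at t)" if "t \<in> S" for t i
      unfolding p_def
      by (rule DERIV_cong[OF DERIV_cmult[OF besselJ_deriv_low(1)[OF Ints(1) S(2)[OF that]]]])
        (simp add: q_def algebra_simps)
    show "((\<lambda>t. q t i) has_real_derivative 2 * p t i - (s + 1 + e i) / t * q t i) (at t)" if "t \<in> S" for t i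
      unfolding q_def
      by (rule DERIV_cong[OF DERIV_cmult[OF besselJ_deriv_low(2)[OF Ints(2) S(2)[OF that]]]])
        (simp add: p_def algebra_simps)
  qed
qed

text \<open>This makes positivity of Q at \<open>L\<close> persist nearby, and it bounds Q at s + 1
  and s - 1 when limits are multiplied.\<close>

lemma Qsig_continuous:
  assumes "admissible \<sigma>" "s \<in> Zh"
  shows "continuous_on {- r..r} (\<lambda>t. Qsig \<sigma> t s)"
  by (rule uniform_limit_theorem[OF _ Qsig_cutoff_uniform[OF assms]])
    (auto intro!: always_eventually Qsig_cutoff_continuous assms)

section \<open>The equation for general sigma\<close>

lemma toda_radial:
  assumes \<sigma>: "admissible \<sigma>" and s: "s \<in> Zh" and L: "L > 0" and pos: "Qsig \<sigma> L s > 0"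
  shows "\<exists>a b F'. a < L \<and> L < b \<and> (\<forall>t\<in>{a<..<b}. ((\<lambda>t. ln (Qsig \<sigma> t s)) has_real_derivative F' t) (at t) \<and>
    (F' has_real_derivative
      4 * (Qsig \<sigma> t (s + 1) * Qsig \<sigma> t (s - 1) / (Qsig \<sigma> t s)\<^sup>2) - 4 - F' t / t) (at t))"
proof -
  let ?I = "{- (2 * L)..2 * L}"
  let ?Q = "\<lambda>N t s. Qsig (cutoff N \<sigma>) t s"
  note s' = Zh_add_1[OF s] Zh_diff_1[OF s]
  \<comment> \<open>Near \<open>L\<close> the function Q exceeds half its value at \<open>L\<close>.
    A cutoff within \<delta> of it is then positive, and the limiting denominator stays above
    \<delta>^2.\<close>
  define \<delta> where "\<delta> = Qsig \<sigma> L s / 2"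
  have \<delta>: "\<delta> > 0" using pos by (simp add: \<delta>_def)
  have "isCont (\<lambda>t. Qsig \<sigma> t s) L"
    using Qsig_continuous[OF \<sigma> s, of "2 * L"] L by (intro continuous_on_interior[of ?I]) auto
  then have "\<forall>\<^sub>F t in at L. \<delta> < Qsig \<sigma> t s"
    using pos unfolding isCont_def by (intro order_tendstoD(1)[where y = "Qsig \<sigma> L s"]) (auto simp: \<delta>_def)
  then obtain d where d: "d > 0" "\<And>t. t \<noteq> L \<Longrightarrow> dist t L < d \<Longrightarrow> \<delta> < Qsig \<sigma> t s"
    unfolding eventually_at by auto
  \<comment> \<open>The bound L/2 keeps \<open>t\<close> positive, 2L keeps the interval inside
    \<open>?I\<close>, and \<open>d\<close> keeps Q above \<delta>.\<close>
  define a b where "a = max (L / 2) (L - d)" and "b = min (2 * L) (L + d)"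
  let ?S = "{a<..<b}"
  have ab: "0 < a" "a < L" "L < b" using L d by (auto simp: a_def b_def)
  have SI: "?S \<subseteq> ?I" using L by (auto simp: a_def b_def)
  have low: "\<delta> < Qsig \<sigma> t s" if "t \<in> ?S" for t
    using d(2)[of t] that \<delta> by (cases "t = L") (auto simp: a_def b_def dist_real_def \<delta>_def)
  have unif: "uniform_limit ?S (\<lambda>N t. ?Q N t u) (\<lambda>t. Qsig \<sigma> t u) sequentially" if "u \<in> Zh" for u
    by (rule uniform_limit_on_subset[OF Qsig_cutoff_uniform[OF \<sigma> that] SI])
  have bdd: "bounded ((\<lambda>t. Qsig \<sigma> t u) ` ?S)" if "u \<in> Zh" for u
    by (rule bounded_subset[OF compact_imp_bounded[OF compact_continuous_image[OF Qsig_continuous[OF \<sigma> that, of "2 * L"]]]])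
      (use SI in auto)
  have "\<forall>\<^sub>F N in sequentially. \<forall>t\<in>?S. dist (?Q N t s) (Qsig \<sigma> t s) < \<delta>"
    using unif[OF s] \<delta> unfolding uniform_limit_iff by blast
  \<comment> \<open>The first cutoffs may fail to be positive, so the approximating sequence is
    started at \<open>N0\<close>.\<close>
  then obtain N0 where N0: "\<And>N t. N \<ge> N0 \<Longrightarrow> t \<in> ?S \<Longrightarrow> dist (?Q N t s) (Qsig \<sigma> t s) < \<delta>"
    unfolding eventually_sequentially by blast
  have Qpos: "?Q (n + N0) t s > 0" if "t \<in> ?S" for n t
    using N0[of "n + N0" t] low[OF that] that by (simp add: dist_real_def)
  have shift: "uniform_limit ?S (\<lambda>n t. ?Q (n + N0) t u) (\<lambda>t. Qsig \<sigma> t u) sequentially" if "u \<in> Zh" for u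
    by (rule filterlim_compose[OF unif[OF that] filterlim_add_const_nat_at_top])
  have "\<exists>f'. \<forall>t\<in>?S. ((\<lambda>t. ln (?Q (n + N0) t s)) has_real_derivative f' t) (at t) \<and>
    (f' has_real_derivative 4 * (?Q (n + N0) t (s + 1) * ?Q (n + N0) t (s - 1) / (?Q (n + N0) t s)\<^sup>2) - 4 - f' t / t) (at t)" for n
    using ab(1) Qpos by (intro toda_cutoff[OF \<sigma> s]) auto
  then obtain f' where f': "\<And>n. \<forall>t\<in>?S. ((\<lambda>t. ln (?Q (n + N0) t s)) has_real_derivative f' n t) (at t) \<and>
    (f' n has_real_derivative 4 * (?Q (n + N0) t (s + 1) * ?Q (n + N0) t (s - 1) / (?Q (n + N0) t s)\<^sup>2) - 4 - f' n t / t) (at t)"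
    by metis
  have "\<exists>F'. \<forall>t\<in>?S. ((\<lambda>t. ln (Qsig \<sigma> t s)) has_real_derivative F' t) (at t) \<and>
    (F' has_real_derivative
      4 * (Qsig \<sigma> t (s + 1) * Qsig \<sigma> t (s - 1) / (Qsig \<sigma> t s)\<^sup>2) - 4 - F' t / t) (at t)"
  proof (rule radial_ode_limit[where a = a and b = b])
    show "0 < a" "a < b" using ab by auto
    show "((\<lambda>t. ln (?Q (n + N0) t s)) has_real_derivative f' n t) (at t)" if "t \<in> ?S" for n t
      using f' that by blast
    show "(f' n has_real_derivative
        4 * (?Q (n + N0) t (s + 1) * ?Q (n + N0) t (s - 1) / (?Q (n + N0) t s)\<^sup>2) - 4 - f' n t / t) (at t)"
      if "t \<in> ?S" for n t using f' that by blast
    show "(\<lambda>n. ln (?Q (n + N0) t s)) \<longlonglongrightarrow> ln (Qsig \<sigma> t s)" if "t \<in> ?S" for t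
      using low[OF that] \<delta> by (intro tendsto_ln tendsto_uniform_limitI[OF shift[OF s] that]) auto
    have "uniform_limit ?S (\<lambda>n t. ?Q (n + N0) t (s + 1) * ?Q (n + N0) t (s - 1) / (?Q (n + N0) t s * ?Q (n + N0) t s))
      (\<lambda>t. Qsig \<sigma> t (s + 1) * Qsig \<sigma> t (s - 1) / (Qsig \<sigma> t s * Qsig \<sigma> t s)) sequentially"
    proof (rule uniform_lim_divide[where b = "\<delta> * \<delta>"])
      show "uniform_limit ?S (\<lambda>n t. ?Q (n + N0) t (s + 1) * ?Q (n + N0) t (s - 1))
        (\<lambda>t. Qsig \<sigma> t (s + 1) * Qsig \<sigma> t (s - 1)) sequentially"
        by (intro uniform_lim_mult shift bdd s')
      show "uniform_limit ?S (\<lambda>n t. ?Q (n + N0) t s * ?Q (n + N0) t s) (\<lambda>t. Qsig \<sigma> t s * Qsig \<sigma> t s) sequentially"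
        by (intro uniform_lim_mult shift bdd s)
      obtain A B where "\<forall>t\<in>?S. \<bar>Qsig \<sigma> t (s + 1)\<bar> \<le> A" "\<forall>t\<in>?S. \<bar>Qsig \<sigma> t (s - 1)\<bar> \<le> B"
        using bdd[OF s'(1)] bdd[OF s'(2)] unfolding bounded_iff by auto
      then have "\<bar>Qsig \<sigma> t (s + 1) * Qsig \<sigma> t (s - 1)\<bar> \<le> A * B" if "t \<in> ?S" for t
        unfolding abs_mult using that by (intro mult_mono) (auto intro: order_trans[OF abs_ge_zero])
      then show "bounded ((\<lambda>t. Qsig \<sigma> t (s + 1) * Qsig \<sigma> t (s - 1)) ` ?S)"
        unfolding bounded_iff by (intro exI[of _ "A * B"]) auto
      show "\<delta> * \<delta> \<le> norm (Qsig \<sigma> t s * Qsig \<sigma> t s)" if "t \<in> ?S" for t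
        using low[OF that] \<delta> by (auto simp: abs_mult intro!: mult_mono)
      show "0 < \<delta> * \<delta>" using \<delta> by simp
    qed
    then have "uniform_limit ?S (\<lambda>n t. 4 * (?Q (n + N0) t (s + 1) * ?Q (n + N0) t (s - 1) / (?Q (n + N0) t s * ?Q (n + N0) t s)) - 4)
      (\<lambda>t. 4 * (Qsig \<sigma> t (s + 1) * Qsig \<sigma> t (s - 1) / (Qsig \<sigma> t s * Qsig \<sigma> t s)) - 4) sequentially"
      by (intro uniform_limit_minus bounded_linear.uniform_limit[OF bounded_linear_mult_right] uniform_limit_const)
    then show "uniform_limit ?S (\<lambda>n t. 4 * (?Q (n + N0) t (s + 1) * ?Q (n + N0) t (s - 1) / (?Q (n + N0) t s)\<^sup>2) - 4)
      (\<lambda>t. 4 * (Qsig \<sigma> t (s + 1) * Qsig \<sigma> t (s - 1) / (Qsig \<sigma> t s)\<^sup>2) - 4) sequentially"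
      by (simp only: power2_eq_square)
  qed
  then show ?thesis using ab(2,3) by blast
qed

theorem theoremI:
  fixes \<sigma> :: "real \<Rightarrow> real" and L s :: real
  assumes "L > 0"
    and "\<And>l. l \<in> Zh \<Longrightarrow> 0 \<le> \<sigma> l \<and> \<sigma> l \<le> 1"
    and "\<sigma> summable_on {l \<in> Zh. l < 0}"
    and "s \<in> Zh"
    and "Qsig \<sigma> L s > 0"
  shows "(\<lambda>t. ln (Qsig \<sigma> t s)) differentiable (at L) \<and>
         deriv (\<lambda>t. ln (Qsig \<sigma> t s)) differentiable (at L) \<and>
         deriv (deriv (\<lambda>t. ln (Qsig \<sigma> t s))) L
           + deriv (\<lambda>t. ln (Qsig \<sigma> t s)) L / L + 4
         = 4 * (Qsig \<sigma> L (s + 1) * Qsig \<sigma> L (s - 1)) / (Qsig \<sigma> L s)\<^sup>2"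
proof -
  let ?f = "\<lambda>t. ln (Qsig \<sigma> t s)"
  have "admissible \<sigma>" using assms(2,3) by (simp add: admissible_def)
  from toda_radial[OF this assms(4,1,5)] obtain a b F' where ab: "a < L" "L < b"
    and F: "\<And>t. t \<in> {a<..<b} \<Longrightarrow> (?f has_real_derivative F' t) (at t)"
    and F': "\<And>t. t \<in> {a<..<b} \<Longrightarrow> (F' has_real_derivative
      4 * (Qsig \<sigma> t (s + 1) * Qsig \<sigma> t (s - 1) / (Qsig \<sigma> t s)\<^sup>2) - 4 - F' t / t) (at t)"
    by blast
  have L: "L \<in> {a<..<b}" using ab by simp
  have d: "deriv ?f t = F' t" if "t \<in> {a<..<b}" for t by (rule DERIV_imp_deriv[OF F[OF that]])
  \<comment> \<open>\<open>deriv ?f\<close> agrees with \<open>F'\<close> on an open interval around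
    \<open>L\<close>, not just at \<open>L\<close>; this is what lets its derivative be
    taken.\<close>
  have d2: "(deriv ?f has_real_derivative
      4 * (Qsig \<sigma> L (s + 1) * Qsig \<sigma> L (s - 1) / (Qsig \<sigma> L s)\<^sup>2) - 4 - F' L / L) (at L)"
    by (rule has_field_derivative_transform_within_open[OF F'[OF L] _ L]) (auto simp: d)
  show ?thesis
  proof (intro conjI)
    show "?f differentiable (at L)" using F[OF L] by (auto simp: real_differentiable_def)
    show "deriv ?f differentiable (at L)" using d2 by (auto simp: real_differentiable_def)
    show "deriv (deriv ?f) L + deriv ?f L / L + 4
        = 4 * (Qsig \<sigma> L (s + 1) * Qsig \<sigma> L (s - 1)) / (Qsig \<sigma> L s)\<^sup>2"
      unfolding DERIV_imp_deriv[OF d2] d[OF L] by simp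
  qed
qed

end
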